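(* Let $M$ be a smooth Banach Poisson manifold, let $G$ be a compact Lie group acting canonically on $M$ with equivariant momentum map $\mathbf{J}\colon M\to\mathfrak{g}^*$, and let $H$ be a $G$-invariant Hamiltonian with Hamiltonian vector field $X_H$. Let $z_e\in M$ be a relative equilibrium with $X_H(z_e)=\xi_M(z_e)$, $\xi\in\mathfrak{g}$, and let $\mu=\mathbf{J}(z_e)$. Let $V$ be an inner product space and $\mathbf{C}\colon M\to V$ a map invariant under the $G_\mu$-action and under the flow of $X_H$. Let $S$ be the $G_\mu$-slice through $z_e$, regarded as a ball centered at the origin in a Banach space with $G_{z_e}$-invariant norm $\|\cdot\|$. For $\lambda\in V^*$ and $\sigma\in\mathbb{R}$ let $\mathcal{H}$ and $\mathcal{H}_\sigma$ be the functions defined in the context. Suppose that $H$, $\mathbf{J}$ and $\mathbf{C}$ are continuous and that there exist $\lambda\in V^*$ and $\sigma\in\mathbb{R}$ such that (1) $z_e$ is a critical point of $\mathcal{H}$; (2) there exists a real number $C>0$ such that $$C\,\|\Delta z\|^2\le D^2\mathcal{H}_\sigma(z)(\Delta z,\Delta z)$$ for all $z$ in $S$ near the origin and for all $\Delta z$ in $S$; and (3) $G_{z_e}\subseteq G_\xi$. Then $z_e$ is Liapunov stable in the following sense: letting $P$ be the $G_\mu$-invariant function on the tube $G_\mu\cdot S$ whose restriction to $S$ is $\|\cdot\|^2$, for every $\epsilon>0$ there exists a neighborhood $U$ of the orbit $G_\mu\cdot z_e$ such that every integral curve $u(t)$ of $X_H$ with $u(0)\in U$ stays in $G_\mu\cdot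 S$ and satisfies $P(u(t))<\epsilon$ for all $t\ge 0$ for which $u(t)$ is defined.
   Context: $\mathfrak{g}$ is the Lie algebra of $G$, $\mathfrak{g}^*$ its dual, and $\langle\cdot,\cdot\rangle$ denotes duality pairings. $\zeta_M$ is the infinitesimal generator on $M$ of $\zeta\in\mathfrak{g}$. $G_\mu$ is the isotropy subgroup of $\mu$ for the coadjoint action, $G_\xi$ that of $\xi$ for the adjoint action, and $G_{z_e}$ that of $z_e$ (by equivariance of $\mathbf{J}$, $G_{z_e}\subseteq G_\mu$). A canonical action is one preserving the Poisson bracket. As usual, $H$ and $\mathbf{J}$ are conserved along integral curves of $X_H$; invariance of $\mathbf{C}$ under the flow means that $\mathbf{C}$ is constant along integral curves. Existence and uniqueness of integral curves of $X_H$ are not assumed. Fix $G_\mu$-invariant norms $\|\cdot\|_{\mathfrak{g}}$ and $\|\cdot\|_{\mathfrak{g}^*}$ on $\mathfrak{g}$ and $\mathfrak{g}^*$ with $\langle\alpha,\zeta\rangle\le\|\alpha\|_{\mathfrak{g}^*}\|\zeta\|_{\mathfrak{g}}$ for all $\alpha\in\mathfrak{g}^*$, $\zeta\in\mathfrak{g}$. For $\lambda\in V^*$ and $\sigma\in\mathbb{R}$ define, for $z\in M$, $$\mathcal{H}(z)=H(z)-\langle\mathbf{J}(z),\xi\rangle+\langle\lambda,\mathbf{C}(z)\rangle,$$ $$f_2(z)=\|\mathbf{J}(z)-\mu\|_{\mathfrak{g}^*}^2+\|\mathbf{C}(z)-\mathbf{C}(z_e)\|_V^2,\qquad \mathcal{H}_\sigma(z)=\mathcal{H}(z)+\sigma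 f_2(z).$$ The $G_\mu$-slice $S$ through $z_e$: by the Slice Theorem a $G_\mu$-invariant neighborhood of the orbit $G_\mu\cdot z_e$ is $G_\mu$-equivariantly diffeomorphic to the associated bundle $G_\mu\times_{G_{z_e}}S$, where $S$ is an open ball centered at the origin in a Banach space on which $G_{z_e}$ acts linearly and isometrically, $[e,0]$ corresponds to $z_e$, and $S$ is identified with $\{[e,s]:s\in S\}\subset M$. The tube $G_\mu\cdot S$ is this neighborhood. In condition (2), $D^2\mathcal{H}_\sigma(z)$ is the second derivative at $z$ of the restriction of $\mathcal{H}_\sigma$ to $S$. The derivatives written in (1) and (2) are understood to exist: $\mathcal{H}$ is differentiable at $z_e$, and $\mathcal{H}_\sigma|_S$ is twice differentiable near the origin. *)

theory Defs
  imports "HOL-Analysis.Analysis" "HOL-Algebra.Group"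
begin

section \<open>Smooth maps between normed spaces\<close>

text \<open>
  \<open>D x [v\<^sub>1, \<dots>, v\<^sub>k]\<close> is the \<open>k\<close>-th Frechet derivative of \<open>f\<close> at \<open>x\<close> applied to \<open>v\<^sub>1, \<dots>, v\<^sub>k\<close>.
  Lists are used because the target space of the \<open>k\<close>-th derivative, the bounded \<open>k\<close>-linear maps
  with the norm \<open>sup \<parallel>T vs\<parallel> / \<Prod>\<parallel>v\<^sub>i\<parallel>\<close>, would otherwise be a type depending on \<open>k\<close>.
  The last clause says that the \<open>k\<close>-th derivative is Frechet differentiable with respect to this
  norm.  The definition is meant for open \<open>X\<close>.
\<close>

definition smooth_on :: "'a::real_normed_vector set \<Rightarrow> ('a \<Rightarrow> 'b::real_normed_vector) \<Rightarrow> bool" where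
  "smooth_on X f \<longleftrightarrow> (\<exists>D :: 'a \<Rightarrow> 'a list \<Rightarrow> 'b. \<forall>x\<in>X.
      D x [] = f x \<and>
      (\<forall>us vs. linear (\<lambda>v. D x (us @ v # vs))) \<and>
      (\<forall>k. \<exists>B. \<forall>vs. length vs = k \<longrightarrow> norm (D x vs) \<le> B * prod_list (map norm vs)) \<and>
      (\<forall>k. \<forall>e>0. \<exists>d>0. \<forall>y\<in>X. norm (y - x) < d \<longrightarrow>
         (\<forall>vs. length vs = k \<longrightarrow>
            norm (D y vs - D x vs - D x ((y - x) # vs)) \<le> e * norm (y - x) * prod_list (map norm vs))))"

text \<open>\<open>D\<close> is the second Frechet derivative of \<open>f\<close> at \<open>x\<close>.\<close>

definition has_second_derivative ::
    "('b::real_normed_vector \<Rightarrow> real) \<Rightarrow> ('b \<Rightarrow>\<^sub>L 'b \<Rightarrow>\<^sub>L real) \<Rightarrow> 'b \<Rightarrow> bool" where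
  "has_second_derivative f D x \<longleftrightarrow> (\<exists>D1 :: 'b \<Rightarrow> 'b \<Rightarrow>\<^sub>L real.
      (\<forall>\<^sub>F y in nhds x. (f has_derivative blinfun_apply (D1 y)) (at y)) \<and>
      (D1 has_derivative blinfun_apply D) (at x))"


section \<open>Banach manifolds\<close>

text \<open>A chart is a pair of its domain and the coordinate map, which is irrelevant off the domain.\<close>

type_synonym ('m, 'e) chart = "'m set \<times> ('m \<Rightarrow> 'e)"

definition chart_inv :: "('m, 'e) chart \<Rightarrow> 'e \<Rightarrow> 'm" where
  "chart_inv c = inv_into (fst c) (snd c)"

definition charts_at :: "('m, 'e) chart set \<Rightarrow> 'm \<Rightarrow> ('m, 'e) chart set" where
  "charts_at A z = {c \<in> A. z \<in> fst c}"

text \<open>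
  Manifolds are Hausdorff and regular (sort \<open>t3_space\<close>), which is implied by the usual convention
  that manifolds are Hausdorff and paracompact.
\<close>

definition banach_manifold :: "('m::t3_space, 'e::banach) chart set \<Rightarrow> bool" where
  "banach_manifold A \<longleftrightarrow>
     (\<Union>c\<in>A. fst c) = UNIV \<and>
     (\<forall>c\<in>A. open (fst c) \<and> open (snd c ` fst c) \<and>
        homeomorphism (fst c) (snd c ` fst c) (snd c) (chart_inv c)) \<and>
     (\<forall>c\<in>A. \<forall>d\<in>A. smooth_on (snd c ` (fst c \<inter> fst d)) (snd d \<circ> chart_inv c))"

definition model_atlas :: "('e, 'e) chart set" where
  "model_atlas = {(UNIV, id)}"

definition prod_atlas ::
    "('m, 'e) chart set \<Rightarrow> ('n, 'f) chart set \<Rightarrow> ('m \<times> 'n, 'e \<times> 'f) chart set" where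
  "prod_atlas A B = {(fst c \<times> fst d, map_prod (snd c) (snd d)) | c d. c \<in> A \<and> d \<in> B}"

definition smooth_map_open ::
    "('m::topological_space, 'e::real_normed_vector) chart set \<Rightarrow>
     ('n::topological_space, 'f::real_normed_vector) chart set \<Rightarrow> 'm set \<Rightarrow> ('m \<Rightarrow> 'n) \<Rightarrow> bool" where
  "smooth_map_open A B W f \<longleftrightarrow> open W \<and> continuous_on W f \<and>
     (\<forall>c\<in>A. \<forall>d\<in>B. smooth_on (snd c ` (fst c \<inter> W \<inter> f -` fst d)) (snd d \<circ> f \<circ> chart_inv c))"

text \<open>
  Smoothness on an arbitrary subset means existence of local smooth extensions; on an embedded
  submanifold (such as a closed subgroup of a Lie group) this is smoothness for the induced
  manifold structure.
\<close>

definition smooth_map_on ::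
    "('m::topological_space, 'e::real_normed_vector) chart set \<Rightarrow>
     ('n::topological_space, 'f::real_normed_vector) chart set \<Rightarrow> 'm set \<Rightarrow> ('m \<Rightarrow> 'n) \<Rightarrow> bool" where
  "smooth_map_on A B X f \<longleftrightarrow>
     (\<forall>x\<in>X. \<exists>W f'. x \<in> W \<and> smooth_map_open A B W f' \<and> (\<forall>y\<in>X \<inter> W. f' y = f y))"

definition diff_in_chart ::
    "('m, 'e::real_normed_vector) chart \<Rightarrow> ('m \<Rightarrow> real) \<Rightarrow> 'm \<Rightarrow> 'e \<Rightarrow>\<^sub>L real" where
  "diff_in_chart c f z = Blinfun (frechet_derivative (f \<circ> chart_inv c) (at (snd c z)))"

definition mdifferentiable_at ::
    "('m, 'e::real_normed_vector) chart set \<Rightarrow> ('m \<Rightarrow> 'b::real_normed_vector) \<Rightarrow> 'm \<Rightarrow> bool" where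
  "mdifferentiable_at A f z \<longleftrightarrow>
     (\<forall>c\<in>charts_at A z. (f \<circ> chart_inv c) differentiable (at (snd c z)))"

definition critical_point ::
    "('m, 'e::real_normed_vector) chart set \<Rightarrow> ('m \<Rightarrow> real) \<Rightarrow> 'm \<Rightarrow> bool" where
  "critical_point A f z \<longleftrightarrow>
     (\<forall>c\<in>charts_at A z. ((f \<circ> chart_inv c) has_derivative (\<lambda>v. 0)) (at (snd c z)))"

text \<open>
  A tangent vector at \<open>z\<close> is represented by the family of its coordinate expressions in the charts
  around \<open>z\<close>, extended by \<open>0\<close> to all other charts.  The velocity of a curve is compared with a
  vector field in every chart.
\<close>

definition integral_curve ::
    "('m::topological_space, 'e::real_normed_vector) chart set \<Rightarrow> ('m \<Rightarrow> ('m, 'e) chart \<Rightarrow> 'e) \<Rightarrow>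
     real set \<Rightarrow> (real \<Rightarrow> 'm) \<Rightarrow> bool" where
  "integral_curve A X I u \<longleftrightarrow> is_interval I \<and> continuous_on I u \<and>
     (\<forall>t\<in>I. \<forall>c\<in>charts_at A (u t).
        ((snd c \<circ> u) has_vector_derivative X (u t) c) (at t within I))"


section \<open>Poisson structures and Hamiltonian vector fields\<close>

text \<open>
  A Banach Poisson structure is given by the bundle map \<open>\<sharp> : T\<^sup>*M \<rightarrow> TM\<close>;
  \<open>\<Lambda> c z\<close> is its expression at \<open>z\<close> in the chart \<open>c\<close>.  The bracket is \<open>{f, h} = df(\<sharp> dh)\<close>.
\<close>

definition poisson_bracket ::
    "('m, 'e::banach) chart set \<Rightarrow> (('m, 'e) chart \<Rightarrow> 'm \<Rightarrow> ('e \<Rightarrow>\<^sub>L real) \<Rightarrow>\<^sub>L 'e) \<Rightarrow>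
     ('m \<Rightarrow> real) \<Rightarrow> ('m \<Rightarrow> real) \<Rightarrow> 'm \<Rightarrow> real" where
  "poisson_bracket A \<Lambda> f h z =
     (THE b. \<forall>c\<in>charts_at A z.
        b = blinfun_apply (diff_in_chart c f z) (blinfun_apply (\<Lambda> c z) (diff_in_chart c h z)))"

definition smooth_fun :: "('m::topological_space, 'e::real_normed_vector) chart set \<Rightarrow> ('m \<Rightarrow> real) \<Rightarrow> bool"
  where "smooth_fun A f \<longleftrightarrow> smooth_map_on A model_atlas UNIV f"

definition poisson_structure ::
    "('m::topological_space, 'e::banach) chart set \<Rightarrow>
     (('m, 'e) chart \<Rightarrow> 'm \<Rightarrow> ('e \<Rightarrow>\<^sub>L real) \<Rightarrow>\<^sub>L 'e) \<Rightarrow> bool" where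
  "poisson_structure A \<Lambda> \<longleftrightarrow>
     (\<forall>c\<in>A. smooth_on (snd c ` fst c) (\<lambda>x. \<Lambda> c (chart_inv c x))) \<and>
     (\<forall>z. \<forall>c\<in>charts_at A z. \<forall>d\<in>charts_at A z. \<forall>\<alpha>.
        let T = Blinfun (frechet_derivative (snd d \<circ> chart_inv c) (at (snd c z)))
        in blinfun_apply (\<Lambda> d z) \<alpha> = blinfun_apply T (blinfun_apply (\<Lambda> c z) (\<alpha> o\<^sub>L T))) \<and>
     (\<forall>z. \<forall>c\<in>charts_at A z. \<forall>\<alpha> \<beta>.
        blinfun_apply \<alpha> (blinfun_apply (\<Lambda> c z) \<beta>) = - blinfun_apply \<beta> (blinfun_apply (\<Lambda> c z) \<alpha>)) \<and>
     (\<forall>f h k. smooth_fun A f \<and> smooth_fun A h \<and> smooth_fun A k \<longrightarrow>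
        (\<forall>z. poisson_bracket A \<Lambda> f (poisson_bracket A \<Lambda> h k) z
           + poisson_bracket A \<Lambda> h (poisson_bracket A \<Lambda> k f) z
           + poisson_bracket A \<Lambda> k (poisson_bracket A \<Lambda> f h) z = 0))"

definition hamiltonian_vf ::
    "('m, 'e::banach) chart set \<Rightarrow> (('m, 'e) chart \<Rightarrow> 'm \<Rightarrow> ('e \<Rightarrow>\<^sub>L real) \<Rightarrow>\<^sub>L 'e) \<Rightarrow>
     ('m \<Rightarrow> real) \<Rightarrow> 'm \<Rightarrow> ('m, 'e) chart \<Rightarrow> 'e" where
  "hamiltonian_vf A \<Lambda> h z c =
     (if c \<in> charts_at A z then blinfun_apply (\<Lambda> c z) (diff_in_chart c h z) else 0)"


section \<open>Lie groups and actions\<close>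

definition lie_group :: "'g::t3_space monoid \<Rightarrow> ('g, 'l::banach) chart set \<Rightarrow> bool" where
  "lie_group G AG \<longleftrightarrow> group G \<and> carrier G = UNIV \<and> banach_manifold AG \<and>
     (\<exists>B::'l set. finite B \<and> span B = UNIV) \<and>
     smooth_map_on (prod_atlas AG AG) AG UNIV (\<lambda>(a, b). a \<otimes>\<^bsub>G\<^esub> b) \<and>
     smooth_map_on AG AG UNIV (\<lambda>a. inv\<^bsub>G\<^esub> a)"

definition smooth_action ::
    "'g::topological_space monoid \<Rightarrow> ('g, 'l::real_normed_vector) chart set \<Rightarrow>
     ('m::topological_space, 'e::real_normed_vector) chart set \<Rightarrow> ('g \<Rightarrow> 'm \<Rightarrow> 'm) \<Rightarrow> bool" where
  "smooth_action G AG A \<Phi> \<longleftrightarrow>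
     (\<forall>z. \<Phi> \<one>\<^bsub>G\<^esub> z = z) \<and> (\<forall>a b z. \<Phi> (a \<otimes>\<^bsub>G\<^esub> b) z = \<Phi> a (\<Phi> b z)) \<and>
     smooth_map_on (prod_atlas AG A) A UNIV (\<lambda>(a, z). \<Phi> a z)"

definition canonical_action ::
    "('m::topological_space, 'e::banach) chart set \<Rightarrow>
     (('m, 'e) chart \<Rightarrow> 'm \<Rightarrow> ('e \<Rightarrow>\<^sub>L real) \<Rightarrow>\<^sub>L 'e) \<Rightarrow> ('g \<Rightarrow> 'm \<Rightarrow> 'm) \<Rightarrow> bool" where
  "canonical_action A \<Lambda> \<Phi> \<longleftrightarrow>
     (\<forall>a f h. smooth_fun A f \<and> smooth_fun A h \<longrightarrow>
        (\<forall>z. poisson_bracket A \<Lambda> (f \<circ> \<Phi> a) (h \<circ> \<Phi> a) z = poisson_bracket A \<Lambda> f h (\<Phi> a z)))"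

text \<open>
  The Lie algebra \<open>T\<^sub>eG\<close> is identified with the model space \<open>'l\<close> of \<open>G\<close> through a chart \<open>\<kappa>\<close> around the
  identity, and its dual with \<open>'l \<Rightarrow>\<^sub>L real\<close>.  \<open>Ad_op G \<kappa> a\<close> is the derivative at the identity of
  conjugation by \<open>a\<close>, and \<open>coAd_op G \<kappa> a\<close> is the left action \<open>Ad\<^sup>*\<close> of \<open>a\<inverse>\<close>.
\<close>

definition Ad_op :: "'g monoid \<Rightarrow> ('g, 'l::real_normed_vector) chart \<Rightarrow> 'g \<Rightarrow> 'l \<Rightarrow>\<^sub>L 'l" where
  "Ad_op G \<kappa> a = Blinfun (frechet_derivative
     (snd \<kappa> \<circ> (\<lambda>b. a \<otimes>\<^bsub>G\<^esub> b \<otimes>\<^bsub>G\<^esub> inv\<^bsub>G\<^esub> a) \<circ> chart_inv \<kappa>) (at (snd \<kappa> \<one>\<^bsub>G\<^esub>)))"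

definition coAd_op ::
    "'g monoid \<Rightarrow> ('g, 'l::real_normed_vector) chart \<Rightarrow> 'g \<Rightarrow> ('l \<Rightarrow>\<^sub>L real) \<Rightarrow> 'l \<Rightarrow>\<^sub>L real" where
  "coAd_op G \<kappa> a \<alpha> = \<alpha> o\<^sub>L Ad_op G \<kappa> (inv\<^bsub>G\<^esub> a)"

definition isotropy :: "('g \<Rightarrow> 'x \<Rightarrow> 'x) \<Rightarrow> 'x \<Rightarrow> 'g set" where
  "isotropy act x = {a. act a x = x}"

abbreviation Ad_isotropy :: "'g monoid \<Rightarrow> ('g, 'l::real_normed_vector) chart \<Rightarrow> 'l \<Rightarrow> 'g set" where
  "Ad_isotropy G \<kappa> \<xi> \<equiv> isotropy (\<lambda>a. blinfun_apply (Ad_op G \<kappa> a)) \<xi>"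

abbreviation coAd_isotropy ::
    "'g monoid \<Rightarrow> ('g, 'l::real_normed_vector) chart \<Rightarrow> ('l \<Rightarrow>\<^sub>L real) \<Rightarrow> 'g set" where
  "coAd_isotropy G \<kappa> \<mu> \<equiv> isotropy (coAd_op G \<kappa>) \<mu>"

text \<open>\<open>\<zeta>\<^sub>M(z)\<close> is the derivative at the identity of \<open>a \<mapsto> \<Phi> a z\<close>, applied to \<open>\<zeta>\<close>.\<close>

definition inf_generator ::
    "'g monoid \<Rightarrow> ('g, 'l::real_normed_vector) chart \<Rightarrow> ('m, 'e::real_normed_vector) chart set \<Rightarrow>
     ('g \<Rightarrow> 'm \<Rightarrow> 'm) \<Rightarrow> 'l \<Rightarrow> 'm \<Rightarrow> ('m, 'e) chart \<Rightarrow> 'e" where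
  "inf_generator G \<kappa> A \<Phi> \<zeta> z c =
     (if c \<in> charts_at A z
      then frechet_derivative (snd c \<circ> (\<lambda>a. \<Phi> a z) \<circ> chart_inv \<kappa>) (at (snd \<kappa> \<one>\<^bsub>G\<^esub>)) \<zeta>
      else 0)"

definition equivariant_momentum_map ::
    "'g monoid \<Rightarrow> ('g, 'l::real_normed_vector) chart \<Rightarrow> ('m, 'e::banach) chart set \<Rightarrow>
     (('m, 'e) chart \<Rightarrow> 'm \<Rightarrow> ('e \<Rightarrow>\<^sub>L real) \<Rightarrow>\<^sub>L 'e) \<Rightarrow> ('g \<Rightarrow> 'm \<Rightarrow> 'm) \<Rightarrow> ('m \<Rightarrow> 'l \<Rightarrow>\<^sub>L real) \<Rightarrow> bool"
  where
  "equivariant_momentum_map G \<kappa> A \<Lambda> \<Phi> J \<longleftrightarrow>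
     (\<forall>z. mdifferentiable_at A J z) \<and>
     (\<forall>\<zeta> z. hamiltonian_vf A \<Lambda> (\<lambda>w. blinfun_apply (J w) \<zeta>) z = inf_generator G \<kappa> A \<Phi> \<zeta> z) \<and>
     (\<forall>a z. J (\<Phi> a z) = coAd_op G \<kappa> a (J z))"

definition is_norm :: "('x::real_vector \<Rightarrow> real) \<Rightarrow> bool" where
  "is_norm N \<longleftrightarrow> (\<forall>x. 0 \<le> N x) \<and> (\<forall>x. N x = 0 \<longleftrightarrow> x = 0) \<and>
     (\<forall>r x. N (r *\<^sub>R x) = \<bar>r\<bar> * N x) \<and> (\<forall>x y. N (x + y) \<le> N x + N y)"


section \<open>Slices\<close>

text \<open>
  \<open>assoc_class G K \<rho> a s\<close> is the class \<open>[a, s]\<close> of the associated bundle \<open>Q \<times>\<^sub>K S\<close>, where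
  \<open>h \<in> K\<close> acts on \<open>Q \<times> S\<close> by \<open>(a, s) \<mapsto> (a h\<inverse>, \<rho> h s)\<close>.
\<close>

definition assoc_class ::
    "'g monoid \<Rightarrow> 'g set \<Rightarrow> ('g \<Rightarrow> 'b \<Rightarrow> 'b) \<Rightarrow> 'g \<Rightarrow> 'b \<Rightarrow> ('g \<times> 'b) set" where
  "assoc_class G K \<rho> a s = {(a \<otimes>\<^bsub>G\<^esub> inv\<^bsub>G\<^esub> h, \<rho> h s) | h. h \<in> K}"

definition assoc_bundle ::
    "'g monoid \<Rightarrow> 'g set \<Rightarrow> 'g set \<Rightarrow> ('g \<Rightarrow> 'b \<Rightarrow> 'b) \<Rightarrow> 'b set \<Rightarrow> ('g \<times> 'b) set set" where
  "assoc_bundle G Q K \<rho> S = {assoc_class G K \<rho> a s | a s. a \<in> Q \<and> s \<in> S}"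

definition smooth_linear_isometric_action ::
    "'g::topological_space monoid \<Rightarrow> ('g, 'l::real_normed_vector) chart set \<Rightarrow> 'g set \<Rightarrow>
     ('g \<Rightarrow> 'b::banach \<Rightarrow> 'b) \<Rightarrow> bool" where
  "smooth_linear_isometric_action G AG K \<rho> \<longleftrightarrow>
     (\<forall>h\<in>K. linear (\<rho> h) \<and> (\<forall>v. norm (\<rho> h v) = norm v)) \<and>
     (\<forall>v. \<rho> \<one>\<^bsub>G\<^esub> v = v) \<and>
     (\<forall>h\<in>K. \<forall>k\<in>K. \<forall>v. \<rho> (h \<otimes>\<^bsub>G\<^esub> k) v = \<rho> h (\<rho> k v)) \<and>
     smooth_map_on (prod_atlas AG model_atlas) model_atlas (K \<times> UNIV) (\<lambda>(h, v). \<rho> h v)"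

text \<open>
  \<open>\<Psi>\<close> is a \<open>Q\<close>-equivariant diffeomorphism from \<open>Q \<times>\<^sub>K S\<close> onto an open set, the tube, where \<open>K\<close> is
  the isotropy group of \<open>z\<^sub>e\<close> and \<open>S\<close> is the ball of radius \<open>r\<close>.  The manifold structure of
  \<open>Q \<times>\<^sub>K S\<close> makes the projection from \<open>Q \<times> S\<close> a submersion.  Hence a map out of \<open>Q \<times>\<^sub>K S\<close> is smooth
  iff its composition with the projection is, and a map into \<open>Q \<times>\<^sub>K S\<close> is smooth iff it lifts
  locally to a smooth map into \<open>Q \<times> S\<close>.
\<close>

definition tube ::
    "'g monoid \<Rightarrow> 'g set \<Rightarrow> 'g set \<Rightarrow> ('g \<Rightarrow> 'b::real_normed_vector \<Rightarrow> 'b) \<Rightarrow> real \<Rightarrow>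
     (('g \<times> 'b) set \<Rightarrow> 'm) \<Rightarrow> 'm set" where
  "tube G Q K \<rho> r \<Psi> = \<Psi> ` assoc_bundle G Q K \<rho> (ball 0 r)"

definition slice_through ::
    "'g::topological_space monoid \<Rightarrow> ('g, 'l::real_normed_vector) chart set \<Rightarrow>
     ('m::topological_space, 'e::real_normed_vector) chart set \<Rightarrow> ('g \<Rightarrow> 'm \<Rightarrow> 'm) \<Rightarrow> 'g set \<Rightarrow> 'm \<Rightarrow>
     ('g \<Rightarrow> 'b::banach \<Rightarrow> 'b) \<Rightarrow> real \<Rightarrow> (('g \<times> 'b) set \<Rightarrow> 'm) \<Rightarrow> bool" where
  "slice_through G AG A \<Phi> Q ze \<rho> r \<Psi> \<longleftrightarrow>
     (let K = Q \<inter> isotropy \<Phi> ze; S = ball 0 r; T = tube G Q K \<rho> r \<Psi>; cl = assoc_class G K \<rho> in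
      0 < r \<and>
      smooth_linear_isometric_action G AG K \<rho> \<and>
      open T \<and>
      inj_on \<Psi> (assoc_bundle G Q K \<rho> S) \<and>
      (\<forall>a\<in>Q. \<forall>b\<in>Q. \<forall>s\<in>S. \<Psi> (cl (a \<otimes>\<^bsub>G\<^esub> b) s) = \<Phi> a (\<Psi> (cl b s))) \<and>
      \<Psi> (cl \<one>\<^bsub>G\<^esub> 0) = ze \<and>
      smooth_map_on (prod_atlas AG model_atlas) A (Q \<times> S) (\<lambda>(a, s). \<Psi> (cl a s)) \<and>
      (\<forall>z\<in>T. \<exists>W L. open W \<and> z \<in> W \<and>
         smooth_map_on A (prod_atlas AG model_atlas) W L \<and>
         (\<forall>w\<in>W. L w \<in> Q \<times> S \<and> \<Psi> (cl (fst (L w)) (snd (L w))) = w)))"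

text \<open>The embedding \<open>s \<mapsto> [e, s]\<close> of the slice into the manifold.\<close>

definition slice_embedding ::
    "'g monoid \<Rightarrow> 'g set \<Rightarrow> ('g \<Rightarrow> 'b \<Rightarrow> 'b) \<Rightarrow> (('g \<times> 'b) set \<Rightarrow> 'm) \<Rightarrow> 'b \<Rightarrow> 'm" where
  "slice_embedding G K \<rho> \<Psi> s = \<Psi> (assoc_class G K \<rho> \<one>\<^bsub>G\<^esub> s)"


section \<open>The augmented Hamiltonians\<close>

definition aug_ham ::
    "('m \<Rightarrow> real) \<Rightarrow> ('m \<Rightarrow> 'l::real_normed_vector \<Rightarrow>\<^sub>L real) \<Rightarrow> ('m \<Rightarrow> 'v::real_inner) \<Rightarrow>
     'l \<Rightarrow> ('v \<Rightarrow>\<^sub>L real) \<Rightarrow> 'm \<Rightarrow> real" where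
  "aug_ham H J C \<xi> lam z = H z - blinfun_apply (J z) \<xi> + blinfun_apply lam (C z)"

definition penalty ::
    "(('l::real_normed_vector \<Rightarrow>\<^sub>L real) \<Rightarrow> real) \<Rightarrow> ('m \<Rightarrow> 'l \<Rightarrow>\<^sub>L real) \<Rightarrow> ('m \<Rightarrow> 'v::real_inner) \<Rightarrow>
     'm \<Rightarrow> 'm \<Rightarrow> real" where
  "penalty Nd J C ze z = (Nd (J z - J ze))\<^sup>2 + (norm (C z - C ze))\<^sup>2"

definition aug_ham_pen ::
    "(('l::real_normed_vector \<Rightarrow>\<^sub>L real) \<Rightarrow> real) \<Rightarrow> ('m \<Rightarrow> real) \<Rightarrow> ('m \<Rightarrow> 'l \<Rightarrow>\<^sub>L real) \<Rightarrow>
     ('m \<Rightarrow> 'v::real_inner) \<Rightarrow> 'm \<Rightarrow> 'l \<Rightarrow> ('v \<Rightarrow>\<^sub>L real) \<Rightarrow> real \<Rightarrow> 'm \<Rightarrow> real" where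
  "aug_ham_pen Nd H J C ze \<xi> lam \<sigma> z = aug_ham H J C \<xi> lam z + \<sigma> * penalty Nd J C ze z"

end

theory Submission
  imports Defs
begin

text \<open>
  Write a point of the tube as \<open>z = \<Phi> a w\<close> with \<open>a \<in> G\<mu>\<close> and \<open>w\<close> on the slice.  Invariance of \<open>H\<close>, \<open>C\<close>
  and of the dual norm under \<open>G\<mu>\<close>, together with equivariance of \<open>J\<close> and
  \<open>coAd_op G \<kappa> a \<mu> = \<mu>\<close>, gives \<open>H w = H z\<close>, \<open>C w = C z\<close> and
  \<open>\<parallel>J w - \<mu>\<parallel> = \<parallel>J z - \<mu>\<parallel>\<close>.  Hence the increase of the penalised augmented Hamiltonian from
  \<open>ze\<close> to \<open>w\<close> is at most
  \<open>E z = \<bar>H z - H ze\<bar> + \<parallel>J z - \<mu>\<parallel> \<parallel>\<xi>\<parallel> + \<bar>lam (C z - C ze)\<bar> + \<bar>\<sigma>\<bar> (\<parallel>J z - \<mu>\<parallel>\<^sup>2 + \<parallel>C z - C ze\<parallel>\<^sup>2)\<close>.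
  The function \<open>E\<close> is continuous, vanishes on the orbit of \<open>ze\<close>, and is constant along integral
  curves, because \<open>H\<close> (\<open>hamiltonian_conserved\<close>), \<open>J\<close> (\<open>momentum_conserved\<close>) and \<open>C\<close> are.

  On the other hand \<open>ze\<close> is a critical point on the slice of the augmented Hamiltonian
  (\<open>critical_point_slice\<close>) and a minimum of the penalty, so it is a critical point of the penalised
  function (\<open>has_derivative_zero_penalty\<close>), and the bound on the second derivative makes that
  function grow at least like \<open>c / 2 \<parallel>s\<parallel>\<^sup>2\<close> (\<open>second_derivative_growth\<close>).  Thus
  \<open>c / 2 P z \<le> E z\<close> near the orbit.

  A curve of small energy that starts near the orbit therefore never meets the set
  \<open>{z. P z = \<eta>\<^sup>2}\<close>.  Since closed balls need not be compact, it must also be excluded that the curve leaves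
  the tube without \<open>P\<close> becoming large, that is, \<open>{z. P z \<le> \<eta>\<^sup>2}\<close> must be closed in the whole manifold
  and not only in the tube.  This holds for small \<open>\<eta>\<close> because \<open>G\<mu>\<close> is compact and the manifold is
  regular (\<open>thin_tube_closure\<close>).  A connectedness argument (\<open>trapped_curve\<close>, \<open>tube_stability\<close>) then
  confines the curve.
\<close>

section \<open>Smooth maps and charts\<close>

lemma smooth_on_differentiable_within:
  assumes "smooth_on X f" "x \<in> X"
  shows "f differentiable (at x within X)"
proof -
  obtain D :: "'a \<Rightarrow> 'a list \<Rightarrow> 'b" where
    D: "\<forall>x\<in>X. D x [] = f x \<and>
      (\<forall>us vs. linear (\<lambda>v. D x (us @ v # vs))) \<and>
      (\<forall>k. \<exists>B. \<forall>vs. length vs = k \<longrightarrow> norm (D x vs) \<le> B * prod_list (map norm vs)) \<and>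
      (\<forall>k. \<forall>e>0. \<exists>d>0. \<forall>y\<in>X. norm (y - x) < d \<longrightarrow>
         (\<forall>vs. length vs = k \<longrightarrow>
            norm (D y vs - D x vs - D x ((y - x) # vs)) \<le> e * norm (y - x) * prod_list (map norm vs)))"
    using assms(1) unfolding smooth_on_def by (elim exE)
  have D0: "D y [] = f y" if "y \<in> X" for y
    using bspec[OF D that] by (rule conjunct1)
  note Dx = bspec[OF D assms(2), THEN conjunct2]
  note lin = Dx[THEN conjunct1, rule_format, of "[]" "[]"]
  obtain B where B: "\<forall>vs. length vs = 1 \<longrightarrow> norm (D x vs) \<le> B * prod_list (map norm vs)"
    using Dx[THEN conjunct2, THEN conjunct1, rule_format, of 1] by (elim exE)
  have "norm (D x [v]) \<le> norm v * B" for v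
    using B[rule_format, of "[v]"] by (simp add: mult.commute)
  then have bl: "bounded_linear (\<lambda>v. D x [v])"
    using lin by (auto intro!: bounded_linear.intro bounded_linear_axioms.intro)
  have "\<exists>d>0. \<forall>y\<in>X. norm (y - x) < d \<longrightarrow> norm (f y - f x - D x [y - x]) \<le> e * norm (y - x)"
    if e: "e > 0" for e
  proof -
    obtain d where d: "d > 0" "\<forall>y\<in>X. norm (y - x) < d \<longrightarrow> (\<forall>vs. length vs = 0 \<longrightarrow>
        norm (D y vs - D x vs - D x ((y - x) # vs)) \<le> e * norm (y - x) * prod_list (map norm vs))"
      using Dx[THEN conjunct2, THEN conjunct2, rule_format, OF e, of 0] by (elim exE conjE)
    have "norm (f y - f x - D x [y - x]) \<le> e * norm (y - x)" if "y \<in> X" "norm (y - x) < d" for y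
      using d(2)[rule_format, OF that, of "[]"] D0[OF that(1)] D0[OF assms(2)] by simp
    then show ?thesis
      using d(1) by blast
  qed
  then have "(f has_derivative (\<lambda>v. D x [v])) (at x within X)"
    unfolding has_derivative_within_alt using bl by blast
  then show ?thesis
    unfolding differentiable_def by blast
qed

lemma smooth_map_on_imp_continuous_on:
  assumes "smooth_map_on A B X f"
  shows "continuous_on X f"
  unfolding continuous_on_def
proof
  fix x assume x: "x \<in> X"
  obtain W f' where W: "x \<in> W" "open W" "continuous_on W f'" and eq: "\<forall>y\<in>X \<inter> W. f' y = f y"
    using assms x unfolding smooth_map_on_def smooth_map_open_def by meson
  have "(f' \<longlongrightarrow> f' x) (at x)"
    using W unfolding continuous_on_def by (metis at_within_open)
  then have "(f' \<longlongrightarrow> f' x) (at x within X)"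
    by (rule filterlim_mono) (auto simp: at_le)
  moreover have "\<forall>\<^sub>F y in at x within X. f' y = f y"
    using W(1,2) eq by (auto simp: eventually_at_topological)
  moreover have "f' x = f x"
    using x W(1) eq by blast
  ultimately show "(f \<longlongrightarrow> f x) (at x within X)"
    by (simp add: tendsto_cong)
qed

lemma chart_facts:
  assumes "banach_manifold A" "c \<in> A"
  shows "open (fst c)" "open (snd c ` fst c)" "continuous_on (fst c) (snd c)"
    "continuous_on (snd c ` fst c) (chart_inv c)" "inj_on (snd c) (fst c)"
    "\<And>z. z \<in> fst c \<Longrightarrow> chart_inv c (snd c z) = z"
    "\<And>y. y \<in> snd c ` fst c \<Longrightarrow> snd c (chart_inv c y) = y \<and> chart_inv c y \<in> fst c"
proof -
  have h: "open (fst c)" "open (snd c ` fst c)"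
      "homeomorphism (fst c) (snd c ` fst c) (snd c) (chart_inv c)"
    using assms unfolding banach_manifold_def by auto
  show "open (fst c)" "open (snd c ` fst c)" "continuous_on (fst c) (snd c)"
    "continuous_on (snd c ` fst c) (chart_inv c)"
    using h unfolding homeomorphism_def by auto
  show inv: "\<And>z. z \<in> fst c \<Longrightarrow> chart_inv c (snd c z) = z"
    using h(3) unfolding homeomorphism_def by auto
  show "inj_on (snd c) (fst c)"
    using inv by (metis inj_on_def)
  show "\<And>y. y \<in> snd c ` fst c \<Longrightarrow> snd c (chart_inv c y) = y \<and> chart_inv c y \<in> fst c"
    using inv by auto
qed

lemma chart_exists:
  assumes "banach_manifold A"
  shows "\<exists>c. c \<in> charts_at A z"
proof -
  have "(\<Union>c\<in>A. fst c) = UNIV"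
    using assms unfolding banach_manifold_def by (rule conjunct1)
  then show ?thesis
    unfolding charts_at_def by blast
qed

lemma prod_atlasI:
  assumes "c \<in> A" "d \<in> B"
  shows "(fst c \<times> fst d, map_prod (snd c) (snd d)) \<in> prod_atlas A B"
  unfolding prod_atlas_def mem_Collect_eq
  by (rule exI[of _ c], rule exI[of _ d]) (simp add: assms)

text \<open>
  The chain rule for a map that is smooth on an arbitrary subset, composed with a map \<open>\<gamma>\<close> into it.
  Only points of \<open>X\<close> are visited by \<open>\<gamma>\<close>, so a local smooth extension of \<open>f\<close> may replace \<open>f\<close>, and the
  chain rule applies to its coordinate expression.
\<close>

lemma smooth_map_on_compose_differentiable:
  fixes \<gamma> :: "'p::real_normed_vector \<Rightarrow> 'n::topological_space"
    and f :: "'n \<Rightarrow> 'm::topological_space"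
  assumes f: "smooth_map_on B A X f" and b: "b \<in> B" "open (fst b)" "inj_on (snd b) (fst b)"
    and c: "c \<in> A" "open (fst c)"
    and p: "\<gamma> p \<in> fst b" "f (\<gamma> p) \<in> fst c"
    and \<gamma>: "(\<gamma> \<longlongrightarrow> \<gamma> p) (nhds p)" "\<forall>\<^sub>F q in nhds p. \<gamma> q \<in> X"
      "(snd b \<circ> \<gamma>) differentiable (at p)"
  shows "(snd c \<circ> f \<circ> \<gamma>) differentiable (at p)"
proof -
  have "\<gamma> p \<in> X"
    using \<gamma>(2) by (rule eventually_nhds_x_imp_x)
  then obtain W f' where W: "\<gamma> p \<in> W" "smooth_map_open B A W f'" and eq: "\<And>y. y \<in> X \<inter> W \<Longrightarrow> f' y = f y"
    using f unfolding smooth_map_on_def by meson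
  define V where "V = fst b \<inter> W \<inter> f' -` fst c"
  have "open (W \<inter> f' -` fst c)"
    using W(2) c(2) by (auto simp: smooth_map_open_def intro: continuous_open_preimage)
  then have "open V"
    using b(2) unfolding V_def by (metis Int_assoc open_Int)
  moreover have "\<gamma> p \<in> V"
    using p W(1) eq \<open>\<gamma> p \<in> X\<close> by (auto simp: V_def)
  ultimately have "\<forall>\<^sub>F q in nhds p. \<gamma> q \<in> V"
    using topological_tendstoD[OF \<gamma>(1)] by simp
  with \<gamma>(2) have "\<forall>\<^sub>F q in nhds p. \<gamma> q \<in> X \<inter> V"
    by eventually_elim auto
  then obtain N where N: "open N" "p \<in> N" "\<And>q. q \<in> N \<Longrightarrow> \<gamma> q \<in> X \<inter> V"
    unfolding eventually_nhds by blast
  let ?g = "snd c \<circ> f' \<circ> chart_inv b"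
  have eq': "?g (snd b (\<gamma> q)) = snd c (f (\<gamma> q))" if "q \<in> N" for q
  proof -
    have "chart_inv b (snd b (\<gamma> q)) = \<gamma> q"
      using N(3)[OF that] b(3) by (auto simp: chart_inv_def V_def)
    then show ?thesis
      using eq[of "\<gamma> q"] N(3)[OF that] by (auto simp: V_def)
  qed
  have "smooth_on (snd b ` V) ?g"
    using W(2) b(1) c(1) unfolding smooth_map_open_def V_def by blast
  then have "?g differentiable (at (snd b (\<gamma> p)) within snd b ` V)"
    using \<open>\<gamma> p \<in> V\<close> by (intro smooth_on_differentiable_within) auto
  then have "?g differentiable (at ((snd b \<circ> \<gamma>) p) within (snd b \<circ> \<gamma>) ` N)"
    using N(3) by (auto intro: differentiable_within_subset)
  moreover have "(snd b \<circ> \<gamma>) differentiable (at p within N)"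
    using \<gamma>(3) differentiable_at_withinI by blast
  ultimately have "(?g \<circ> (snd b \<circ> \<gamma>)) differentiable (at p within N)"
    by (intro differentiable_chain_within)
  then have "(?g \<circ> (snd b \<circ> \<gamma>)) differentiable (at p)"
    using N(1,2) at_within_open by metis
  then obtain L where "((?g \<circ> (snd b \<circ> \<gamma>)) has_derivative L) (at p)"
    unfolding differentiable_def by blast
  then have "((snd c \<circ> f \<circ> \<gamma>) has_derivative L) (at p)"
    by (rule has_derivative_transform_within_open[OF _ N(1,2)]) (use eq' in auto)
  then show ?thesis
    unfolding differentiable_def by blast
qed

section \<open>Conservation laws\<close>

text \<open>
  A function whose differential annihilates the vector field is constant along integral curves, also
  at the end points of the interval, where only one-sided derivatives are available.
\<close>

lemma integral_curve_constant:
  fixes f :: "'m::t3_space \<Rightarrow> real"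
  assumes M: "banach_manifold A" and u: "integral_curve A X I u"
    and f: "\<And>z c. c \<in> charts_at A z \<Longrightarrow>
      \<exists>f'. ((f \<circ> chart_inv c) has_derivative f') (at (snd c z)) \<and> f' (X z c) = 0"
    and st: "s \<in> I" "t \<in> I"
  shows "f (u s) = f (u t)"
proof -
  have I: "convex I" and cont: "continuous_on I u"
    using u unfolding integral_curve_def by (simp_all add: is_interval_convex_1)
  have "((f \<circ> u) has_derivative (\<lambda>h. 0)) (at t within I)" if t: "t \<in> I" for t
  proof -
    obtain c where c: "c \<in> charts_at A (u t)"
      using chart_exists[OF M] by blast
    then have cA: "c \<in> A" "u t \<in> fst c"
      unfolding charts_at_def by auto
    obtain f' where f': "((f \<circ> chart_inv c) has_derivative f') (at (snd c (u t)))" "f' (X (u t) c) = 0"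
      using f[OF c] by (elim exE conjE)
    have "((snd c \<circ> u) has_vector_derivative X (u t) c) (at t within I)"
      using u t c unfolding integral_curve_def by simp
    then have "((snd c \<circ> u) has_derivative (\<lambda>h. h *\<^sub>R X (u t) c)) (at t within I)"
      unfolding has_vector_derivative_def .
    moreover have "((f \<circ> chart_inv c) has_derivative f') (at ((snd c \<circ> u) t) within (snd c \<circ> u) ` I)"
      by (simp only: comp_apply has_derivative_at_withinI[OF f'(1)])
    ultimately have "(((f \<circ> chart_inv c) \<circ> (snd c \<circ> u)) has_derivative (f' \<circ> (\<lambda>h. h *\<^sub>R X (u t) c))) (at t within I)"
      by (rule diff_chain_within)
    moreover have "f' \<circ> (\<lambda>h. h *\<^sub>R X (u t) c) = (\<lambda>h. 0)"
      by (simp add: fun_eq_iff f'(2) linear_scale[OF bounded_linear.linear[OF has_derivative_bounded_linear[OF f'(1)]]])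
    ultimately have d: "(((f \<circ> chart_inv c) \<circ> (snd c \<circ> u)) has_derivative (\<lambda>h. 0)) (at t within I)"
      by simp
    have "(u \<longlongrightarrow> u t) (at t within I)"
      using cont t by (auto simp: continuous_on_def)
    then have "\<forall>\<^sub>F s in at t within I. u s \<in> fst c"
      using chart_facts(1)[OF M cA(1)] cA(2) by (rule topological_tendstoD)
    then have "\<forall>\<^sub>F s in at t within I. ((f \<circ> chart_inv c) \<circ> (snd c \<circ> u)) s = (f \<circ> u) s"
      by eventually_elim (simp add: chart_facts(6)[OF M cA(1)])
    then show ?thesis
      by (rule has_derivative_transform_eventually[OF d]) (simp_all add: t chart_facts(6)[OF M cA])
  qed
  then have "\<exists>k. \<forall>t\<in>I. (f \<circ> u) t = k"
    by (rule has_derivative_zero_constant[OF I])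
  then obtain k where k: "\<forall>t\<in>I. (f \<circ> u) t = k" ..
  show ?thesis
    using bspec[OF k st(1)] bspec[OF k st(2)] by simp
qed

lemma diff_in_chart_has_derivative:
  assumes "(f \<circ> chart_inv c) differentiable (at (snd c z))"
  shows "((f \<circ> chart_inv c) has_derivative blinfun_apply (diff_in_chart c f z)) (at (snd c z))"
  using assms unfolding diff_in_chart_def frechet_derivative_works
  by (simp add: bounded_linear_Blinfun_apply has_derivative_bounded_linear)

lemma poisson_structure_skew:
  assumes "poisson_structure A \<Lambda>" "c \<in> charts_at A z"
  shows "blinfun_apply \<alpha> (blinfun_apply (\<Lambda> c z) \<beta>) = - blinfun_apply \<beta> (blinfun_apply (\<Lambda> c z) \<alpha>)"
  using assms unfolding poisson_structure_def by blast

lemma hamiltonian_conserved: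
  assumes "banach_manifold A" "poisson_structure A \<Lambda>" and H: "\<And>z. mdifferentiable_at A H z"
    and u: "integral_curve A (hamiltonian_vf A \<Lambda> H) I u" "s \<in> I" "t \<in> I"
  shows "H (u s) = H (u t)"
proof (rule integral_curve_constant[OF assms(1) u(1) _ u(2,3)])
  fix z c assume c: "c \<in> charts_at A z"
  have "((H \<circ> chart_inv c) has_derivative blinfun_apply (diff_in_chart c H z)) (at (snd c z))"
    using H c unfolding mdifferentiable_at_def by (intro diff_in_chart_has_derivative) blast
  moreover have "blinfun_apply (diff_in_chart c H z) (hamiltonian_vf A \<Lambda> H z c) = 0"
    using poisson_structure_skew[OF assms(2) c, of "diff_in_chart c H z" "diff_in_chart c H z"] c
    by (simp add: hamiltonian_vf_def)
  ultimately show "\<exists>f'. ((H \<circ> chart_inv c) has_derivative f') (at (snd c z)) \<and>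
      f' (hamiltonian_vf A \<Lambda> H z c) = 0"
    by blast
qed

lemma orbit_map_differentiable:
  fixes G :: "'g::t3_space monoid" and AG :: "('g, 'l::banach) chart set"
    and A :: "('m::t3_space, 'e::banach) chart set"
  assumes M: "banach_manifold A" and G: "banach_manifold AG" and \<Phi>: "smooth_action G AG A \<Phi>"
    and \<kappa>: "\<kappa> \<in> charts_at AG \<one>\<^bsub>G\<^esub>" and c: "c \<in> charts_at A z"
  shows "(snd c \<circ> (\<lambda>a. \<Phi> a z) \<circ> chart_inv \<kappa>) differentiable (at (snd \<kappa> \<one>\<^bsub>G\<^esub>))"
    and "\<forall>\<^sub>F y in nhds (snd \<kappa> \<one>\<^bsub>G\<^esub>). \<Phi> (chart_inv \<kappa> y) z \<in> fst c"
proof -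
  have \<kappa>A: "\<kappa> \<in> AG" "\<one>\<^bsub>G\<^esub> \<in> fst \<kappa>" and cA: "c \<in> A" "z \<in> fst c"
    using \<kappa> c unfolding charts_at_def by auto
  have sm: "smooth_map_on (prod_atlas AG A) A UNIV (\<lambda>(a, z). \<Phi> a z)" and one: "\<Phi> \<one>\<^bsub>G\<^esub> z = z"
    using \<Phi> unfolding smooth_action_def by auto
  let ?p = "snd \<kappa> \<one>\<^bsub>G\<^esub>" and ?b = "(fst \<kappa> \<times> fst c, map_prod (snd \<kappa>) (snd c))"
  let ?\<gamma> = "\<lambda>y. (chart_inv \<kappa> y, z)"
  have p: "?p \<in> snd \<kappa> ` fst \<kappa>" "chart_inv \<kappa> ?p = \<one>\<^bsub>G\<^esub>"
    using \<kappa>A chart_facts(6)[OF G \<kappa>A(1)] by auto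
  have "isCont (chart_inv \<kappa>) ?p"
    using chart_facts(4)[OF G \<kappa>A(1)] p(1) by (simp only: continuous_on_eq_continuous_at[OF chart_facts(2)[OF G \<kappa>A(1)]])
  then have lim: "(chart_inv \<kappa> \<longlongrightarrow> chart_inv \<kappa> ?p) (nhds ?p)"
    unfolding isCont_def by (simp add: tendsto_at_iff_tendsto_nhds)
  have \<gamma>lim: "(?\<gamma> \<longlongrightarrow> ?\<gamma> ?p) (nhds ?p)"
    by (intro tendsto_Pair lim tendsto_const)
  have "((\<lambda>y. (y, snd c z)) has_derivative (\<lambda>h. (h, 0))) (at ?p)"
    by (auto intro!: derivative_eq_intros)
  then have "((snd ?b \<circ> ?\<gamma>) has_derivative (\<lambda>h. (h, 0))) (at ?p)"
    by (rule has_derivative_transform_within_open[OF _ chart_facts(2)[OF G \<kappa>A(1)] p(1)])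
       (use chart_facts(7)[OF G \<kappa>A(1)] in auto)
  then have \<gamma>': "(snd ?b \<circ> ?\<gamma>) differentiable (at ?p)"
    unfolding differentiable_def by blast
  have "(snd c \<circ> (\<lambda>(a, z). \<Phi> a z) \<circ> ?\<gamma>) differentiable (at ?p)"
  proof (rule smooth_map_on_compose_differentiable[OF sm _ _ _ cA(1) _ _ _ \<gamma>lim _ \<gamma>'])
    show "?b \<in> prod_atlas AG A"
      using \<kappa>A(1) cA(1) by (rule prod_atlasI)
    show "open (fst ?b)"
      using chart_facts(1)[OF G \<kappa>A(1)] chart_facts(1)[OF M cA(1)] by (simp add: open_Times)
    show "inj_on (snd ?b) (fst ?b)"
      using map_prod_inj_on[OF chart_facts(5)[OF G \<kappa>A(1)] chart_facts(5)[OF M cA(1)]] by simp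
  qed (use p cA \<kappa>A one chart_facts(1)[OF M cA(1)] in auto)
  then show "(snd c \<circ> (\<lambda>a. \<Phi> a z) \<circ> chart_inv \<kappa>) differentiable (at ?p)"
    by (simp add: comp_def)
  have "isCont (\<lambda>(a, z). \<Phi> a z) (?\<gamma> ?p)"
    using smooth_map_on_imp_continuous_on[OF sm]
    by (simp only: continuous_on_eq_continuous_at[OF open_UNIV] ball_UNIV)
  from isCont_tendsto_compose[OF this \<gamma>lim] have "((\<lambda>y. \<Phi> (chart_inv \<kappa> y) z) \<longlongrightarrow> z) (nhds ?p)"
    by (simp add: p one)
  then show "\<forall>\<^sub>F y in nhds ?p. \<Phi> (chart_inv \<kappa> y) z \<in> fst c"
    using chart_facts(1)[OF M cA(1)] cA(2) by (rule topological_tendstoD)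
qed

text \<open>
  For a component \<open>J\<^sub>\<zeta>\<close> of the momentum map, \<open>\<langle>dJ\<^sub>\<zeta>, X\<^sub>H\<rangle> = - \<langle>dH, \<zeta>\<^sub>M\<rangle>\<close>, and \<open>\<langle>dH, \<zeta>\<^sub>M\<rangle>\<close> is the derivative of the constant function
  \<open>a \<mapsto> H (\<Phi> a z)\<close>.
\<close>

lemma momentum_conserved:
  fixes G :: "'g::t3_space monoid" and AG :: "('g, 'l::banach) chart set"
    and A :: "('m::t3_space, 'e::banach) chart set"
  assumes M: "banach_manifold A" and PS: "poisson_structure A \<Lambda>" and G: "banach_manifold AG"
    and \<Phi>: "smooth_action G AG A \<Phi>" and \<kappa>: "\<kappa> \<in> charts_at AG \<one>\<^bsub>G\<^esub>"
    and J: "equivariant_momentum_map G \<kappa> A \<Lambda> \<Phi> J"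
    and H: "\<And>z. mdifferentiable_at A H z" and inv: "\<And>a z. H (\<Phi> a z) = H z"
    and u: "integral_curve A (hamiltonian_vf A \<Lambda> H) I u" "s \<in> I" "t \<in> I"
  shows "J (u s) = J (u t)"
proof (rule blinfun_eqI)
  fix \<zeta>
  let ?J = "\<lambda>w. blinfun_apply (J w) \<zeta>"
  show "blinfun_apply (J (u s)) \<zeta> = blinfun_apply (J (u t)) \<zeta>"
  proof (rule integral_curve_constant[where f = ?J, OF M u(1) _ u(2,3)])
    fix z c assume c: "c \<in> charts_at A z"
    then have cA: "c \<in> A" "z \<in> fst c"
      unfolding charts_at_def by auto
    have "mdifferentiable_at A J z" and JX: "hamiltonian_vf A \<Lambda> ?J z = inf_generator G \<kappa> A \<Phi> \<zeta> z"
      using J unfolding equivariant_momentum_map_def by simp_all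
    then have "(J \<circ> chart_inv c) differentiable (at (snd c z))"
      using c unfolding mdifferentiable_at_def by simp
    then obtain L where "((J \<circ> chart_inv c) has_derivative L) (at (snd c z))"
      unfolding differentiable_def by blast
    then have "((\<lambda>x. blinfun_apply ((J \<circ> chart_inv c) x) \<zeta>) has_derivative (\<lambda>h. blinfun_apply (L h) \<zeta>))
        (at (snd c z))"
      by (rule bounded_linear.has_derivative[OF bounded_bilinear.bounded_linear_left[OF bounded_bilinear_blinfun_apply]])
    then have "(?J \<circ> chart_inv c) differentiable (at (snd c z))"
      unfolding differentiable_def comp_def by (rule exI[of _ "\<lambda>h. blinfun_apply (L h) \<zeta>"])
    then have dJ: "((?J \<circ> chart_inv c) has_derivative blinfun_apply (diff_in_chart c ?J z)) (at (snd c z))"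
      by (rule diff_in_chart_has_derivative)
    have dH: "((H \<circ> chart_inv c) has_derivative blinfun_apply (diff_in_chart c H z)) (at (snd c z))"
      using H c unfolding mdifferentiable_at_def by (intro diff_in_chart_has_derivative) blast
    let ?p = "snd \<kappa> \<one>\<^bsub>G\<^esub>" and ?o = "snd c \<circ> (\<lambda>a. \<Phi> a z) \<circ> chart_inv \<kappa>"
    note orb = orbit_map_differentiable[OF M G \<Phi> \<kappa> c]
    let ?D = "frechet_derivative ?o (at ?p)"
    have "\<kappa> \<in> AG" "\<one>\<^bsub>G\<^esub> \<in> fst \<kappa>" "\<Phi> \<one>\<^bsub>G\<^esub> z = z"
      using \<kappa> \<Phi> unfolding charts_at_def smooth_action_def by simp_all
    then have p: "?o ?p = snd c z"
      by (simp add: chart_facts(6)[OF G])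
    have "(?o has_derivative ?D) (at ?p)"
      using orb(1) by (simp only: frechet_derivative_works)
    moreover have "((H \<circ> chart_inv c) has_derivative blinfun_apply (diff_in_chart c H z)) (at (?o ?p))"
      using dH by (simp only: p)
    ultimately have d1: "((H \<circ> chart_inv c) \<circ> ?o has_derivative blinfun_apply (diff_in_chart c H z) \<circ> ?D) (at ?p)"
      by (rule diff_chain_at)
    have "\<forall>\<^sub>F y in nhds ?p. ((H \<circ> chart_inv c) \<circ> ?o) y = H z"
      using orb(2) by eventually_elim (simp add: chart_facts(6)[OF M cA(1)] inv)
    note ev = this[unfolded eventually_nhds_conv_at]
    have "((\<lambda>y. H z) has_derivative blinfun_apply (diff_in_chart c H z) \<circ> ?D) (at ?p)"
      by (rule has_derivative_transform_eventually[OF d1 conjunct1[OF ev] conjunct2[OF ev] UNIV_I])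
    then have "blinfun_apply (diff_in_chart c H z) \<circ> ?D = (\<lambda>h. 0)"
      by (rule has_derivative_unique) (rule has_derivative_const)
    then have "(blinfun_apply (diff_in_chart c H z) \<circ> ?D) \<zeta> = 0"
      by (rule fun_cong)
    then have "blinfun_apply (diff_in_chart c H z) (inf_generator G \<kappa> A \<Phi> \<zeta> z c) = 0"
      using c by (simp only: inf_generator_def if_True comp_apply)
    moreover have "inf_generator G \<kappa> A \<Phi> \<zeta> z c = blinfun_apply (\<Lambda> c z) (diff_in_chart c ?J z)"
      using fun_cong[OF JX, of c] c by (simp add: hamiltonian_vf_def)
    ultimately have "blinfun_apply (diff_in_chart c ?J z) (hamiltonian_vf A \<Lambda> H z c) = 0"
      using poisson_structure_skew[OF PS c, of "diff_in_chart c ?J z" "diff_in_chart c H z"] c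
      by (simp add: hamiltonian_vf_def)
    with dJ show "\<exists>f'. ((?J \<circ> chart_inv c) has_derivative f') (at (snd c z)) \<and>
        f' (hamiltonian_vf A \<Lambda> H z c) = 0"
      by (intro exI[of _ "blinfun_apply (diff_in_chart c ?J z)"] conjI)
  qed
qed

section \<open>Norms on the dual of a finite-dimensional space\<close>

text \<open>
  An arbitrary norm on the dual of a finite-dimensional space is bounded by the operator norm.  It is
  stated for a subspace \<open>W\<close> whose elements are determined by their values on \<open>B\<close>, for the sake of
  the induction.  The induction on \<open>B\<close> splits off one coordinate \<open>\<alpha> \<mapsto> \<alpha> b\<close> at a time, so neither a basis of the
  dual space nor the continuity of arbitrary linear functionals is needed.
\<close>

lemma is_norm_dual_bound_subspace:
  fixes Nd :: "('l::real_normed_vector \<Rightarrow>\<^sub>L real) \<Rightarrow> real"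
  assumes Nd: "is_norm Nd" and "finite B" and "subspace W"
    and "\<And>\<alpha>. \<alpha> \<in> W \<Longrightarrow> (\<And>b. b \<in> B \<Longrightarrow> blinfun_apply \<alpha> b = 0) \<Longrightarrow> \<alpha> = 0"
  shows "\<exists>K\<ge>0. \<forall>\<alpha>\<in>W. Nd \<alpha> \<le> K * norm \<alpha>"
  using assms(2-4)
proof (induction B arbitrary: W rule: finite_induct)
  case empty
  then have "Nd \<alpha> \<le> 0 * norm \<alpha>" if "\<alpha> \<in> W" for \<alpha>
    using that Nd by (metis empty_iff is_norm_def mult_zero_left order_refl)
  then show ?case
    by blast
next
  case (insert b B)
  show ?case
  proof (cases "\<forall>\<alpha>\<in>W. blinfun_apply \<alpha> b = 0")
    case True
    show ?thesis
    proof (rule insert.IH[OF insert.prems(1)])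
      fix \<alpha> assume "\<alpha> \<in> W" "\<And>b. b \<in> B \<Longrightarrow> blinfun_apply \<alpha> b = 0"
      then show "\<alpha> = 0"
        using insert.prems(2) True by blast
    qed
  next
    case False
    then obtain \<alpha>\<^sub>1 where \<alpha>\<^sub>1: "\<alpha>\<^sub>1 \<in> W" "blinfun_apply \<alpha>\<^sub>1 b \<noteq> 0"
      by blast
    define \<alpha>\<^sub>0 where "\<alpha>\<^sub>0 = (1 / blinfun_apply \<alpha>\<^sub>1 b) *\<^sub>R \<alpha>\<^sub>1"
    have \<alpha>\<^sub>0: "\<alpha>\<^sub>0 \<in> W" "blinfun_apply \<alpha>\<^sub>0 b = 1"
      using \<alpha>\<^sub>1 insert.prems(1) by (auto simp: \<alpha>\<^sub>0_def subspace_def blinfun.scaleR_left)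
    (* W is the direct sum of this subspace, to which the induction hypothesis applies, and the
       line through \<alpha>\<^sub>0. *)
    let ?W = "{\<alpha>\<in>W. blinfun_apply \<alpha> b = 0}"
    have "subspace ?W"
      using insert.prems(1) by (auto simp: subspace_def blinfun.add_left blinfun.scaleR_left)
    moreover have "\<alpha> = 0" if "\<alpha> \<in> ?W" "\<And>c. c \<in> B \<Longrightarrow> blinfun_apply \<alpha> c = 0" for \<alpha>
      using that insert.prems(2)[of \<alpha>] by auto
    ultimately obtain K where K: "K \<ge> 0" "\<And>\<alpha>. \<alpha> \<in> ?W \<Longrightarrow> Nd \<alpha> \<le> K * norm \<alpha>"
      using insert.IH[of ?W] by blast
    let ?K = "K * (1 + norm b * norm \<alpha>\<^sub>0) + norm b * Nd \<alpha>\<^sub>0"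
    have Nd0: "0 \<le> Nd \<alpha>\<^sub>0"
      using Nd by (simp add: is_norm_def)
    have "Nd \<alpha> \<le> ?K * norm \<alpha>" if \<alpha>: "\<alpha> \<in> W" for \<alpha>
    proof -
      let ?x = "blinfun_apply \<alpha> b"
      let ?\<beta> = "\<alpha> - ?x *\<^sub>R \<alpha>\<^sub>0"
      have x: "\<bar>?x\<bar> \<le> norm \<alpha> * norm b"
        using norm_blinfun[of \<alpha> b] by simp
      have "?\<beta> \<in> ?W"
        using \<alpha> \<alpha>\<^sub>0 insert.prems(1)
        by (simp add: subspace_diff subspace_scale blinfun.diff_left blinfun.scaleR_left)
      then have "Nd ?\<beta> \<le> K * norm ?\<beta>"
        by (rule K(2))
      also have "\<dots> \<le> K * (norm \<alpha> + \<bar>?x\<bar> * norm \<alpha>\<^sub>0)"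
        using norm_triangle_ineq4[of \<alpha> "?x *\<^sub>R \<alpha>\<^sub>0"] K(1) by (simp add: mult_left_mono)
      also have "\<dots> \<le> K * (norm \<alpha> + norm \<alpha> * norm b * norm \<alpha>\<^sub>0)"
        using x K(1) by (intro mult_left_mono add_left_mono mult_right_mono) auto
      finally have 1: "Nd ?\<beta> \<le> K * (norm \<alpha> + norm \<alpha> * norm b * norm \<alpha>\<^sub>0)" .
      have "Nd (?\<beta> + ?x *\<^sub>R \<alpha>\<^sub>0) \<le> Nd ?\<beta> + Nd (?x *\<^sub>R \<alpha>\<^sub>0)"
        using Nd unfolding is_norm_def by blast
      moreover have "Nd (?x *\<^sub>R \<alpha>\<^sub>0) = \<bar>?x\<bar> * Nd \<alpha>\<^sub>0"
        using Nd unfolding is_norm_def by blast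
      moreover have "\<bar>?x\<bar> * Nd \<alpha>\<^sub>0 \<le> norm \<alpha> * norm b * Nd \<alpha>\<^sub>0"
        using x Nd0 by (rule mult_right_mono)
      ultimately show ?thesis
        using 1 by (simp add: algebra_simps)
    qed
    moreover have "?K \<ge> 0"
      using K(1) Nd0 by simp
    ultimately show ?thesis
      by blast
  qed
qed

lemma is_norm_dual_bound:
  fixes Nd :: "('l::real_normed_vector \<Rightarrow>\<^sub>L real) \<Rightarrow> real"
  assumes "is_norm Nd" and B: "finite B" "span B = (UNIV :: 'l set)"
  obtains K where "K \<ge> 0" "\<And>\<alpha>. Nd \<alpha> \<le> K * norm \<alpha>"
proof -
  have "\<alpha> = 0" if "\<And>b. b \<in> B \<Longrightarrow> blinfun_apply \<alpha> b = 0" for \<alpha> :: "'l \<Rightarrow>\<^sub>L real"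
  proof (rule blinfun_eqI)
    fix x
    have "x \<in> span B"
      using B by simp
    then have "blinfun_apply \<alpha> x = 0"
      by (induction rule: span_induct_alt) (auto simp: blinfun.add_right blinfun.scaleR_right that)
    then show "blinfun_apply \<alpha> x = blinfun_apply 0 x"
      by simp
  qed
  then show thesis
    using is_norm_dual_bound_subspace[OF assms(1) B(1), of UNIV] that by auto
qed

lemma is_norm_minus:
  assumes "is_norm Nd"
  shows "Nd (- x) = Nd x"
proof -
  have "Nd ((-1) *\<^sub>R x) = \<bar>-1\<bar> * Nd x"
    using assms unfolding is_norm_def by blast
  then show ?thesis
    by simp
qed

lemma is_norm_continuous:
  fixes Nd :: "'x::real_normed_vector \<Rightarrow> real"
  assumes Nd: "is_norm Nd" and K: "K \<ge> 0" "\<And>x. Nd x \<le> K * norm x"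
  shows "continuous_on UNIV Nd"
proof -
  have N: "Nd (x + y) \<le> Nd x + Nd y" for x y
    using Nd unfolding is_norm_def by blast
  have "K-lipschitz_on UNIV Nd"
  proof (rule lipschitz_onI)
    fix x y
    have "Nd x \<le> Nd (x - y) + Nd y" "Nd y \<le> Nd (y - x) + Nd x"
      using N[of "x - y" y] N[of "y - x" x] by auto
    then have "\<bar>Nd x - Nd y\<bar> \<le> Nd (x - y)"
      using is_norm_minus[OF Nd, of "x - y"] by simp
    then show "dist (Nd x) (Nd y) \<le> K * dist x y"
      using K(2)[of "x - y"] by (simp add: dist_norm)
  qed (rule K)
  then show ?thesis
    by (rule lipschitz_on_continuous_on)
qed

section \<open>Growth near a nondegenerate minimum\<close>

lemma has_second_derivative_along_ray:
  assumes "has_second_derivative F D2 (t *\<^sub>R s)"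
  shows "((\<lambda>t. frechet_derivative F (at (t *\<^sub>R s)) s) has_real_derivative
      blinfun_apply (blinfun_apply D2 s) s) (at t)"
    and "((\<lambda>t. F (t *\<^sub>R s)) has_real_derivative frechet_derivative F (at (t *\<^sub>R s)) s) (at t)"
proof -
  obtain D1 where ev: "\<forall>\<^sub>F y in nhds (t *\<^sub>R s). (F has_derivative blinfun_apply (D1 y)) (at y)"
    and D1: "(D1 has_derivative blinfun_apply D2) (at (t *\<^sub>R s))"
    using assms unfolding has_second_derivative_def by blast
  have ray: "((\<lambda>t. t *\<^sub>R s) has_derivative (\<lambda>h. h *\<^sub>R s)) (at t)"
    by (auto intro!: derivative_eq_intros)
  have fd: "frechet_derivative F (at y) = blinfun_apply (D1 y)"
    if "(F has_derivative blinfun_apply (D1 y)) (at y)" for y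
    using frechet_derivative_at[OF that] by simp
  have F: "(F has_derivative blinfun_apply (D1 (t *\<^sub>R s))) (at (t *\<^sub>R s))"
    using ev by (rule eventually_nhds_x_imp_x)
  have "((\<lambda>t. F (t *\<^sub>R s)) has_derivative (\<lambda>h. blinfun_apply (D1 (t *\<^sub>R s)) (h *\<^sub>R s))) (at t)"
    using has_derivative_compose[OF ray F] .
  then show "((\<lambda>t. F (t *\<^sub>R s)) has_real_derivative frechet_derivative F (at (t *\<^sub>R s)) s) (at t)"
    unfolding has_field_derivative_def fd[OF F] by (simp add: blinfun.scaleR_right mult_commute_abs)
  have "((\<lambda>t. D1 (t *\<^sub>R s)) has_derivative (\<lambda>h. blinfun_apply D2 (h *\<^sub>R s))) (at t)"
    using has_derivative_compose[OF ray D1] .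
  then have "((\<lambda>t. blinfun_apply (D1 (t *\<^sub>R s)) s) has_derivative
      (\<lambda>h. blinfun_apply (blinfun_apply D2 (h *\<^sub>R s)) s)) (at t)"
    by (rule bounded_linear.has_derivative[OF bounded_bilinear.bounded_linear_left[OF bounded_bilinear_blinfun_apply]])
  then have D: "((\<lambda>t. blinfun_apply (D1 (t *\<^sub>R s)) s) has_real_derivative
      blinfun_apply (blinfun_apply D2 s) s) (at t)"
    unfolding has_field_derivative_def
    by (simp add: blinfun.scaleR_right blinfun.scaleR_left mult_commute_abs)
  have "((\<lambda>t. t *\<^sub>R s) \<longlongrightarrow> t *\<^sub>R s) (nhds t)"
    by (intro tendsto_intros) (simp add: filterlim_ident)
  then have "\<forall>\<^sub>F t' in nhds t. (F has_derivative blinfun_apply (D1 (t' *\<^sub>R s))) (at (t' *\<^sub>R s))"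
    using eventually_compose_filterlim[OF ev] by blast
  then have "\<forall>\<^sub>F t' in nhds t. blinfun_apply (D1 (t' *\<^sub>R s)) s = frechet_derivative F (at (t' *\<^sub>R s)) s"
    by eventually_elim (simp add: fd)
  with D show "((\<lambda>t. frechet_derivative F (at (t *\<^sub>R s)) s) has_real_derivative
      blinfun_apply (blinfun_apply D2 s) s) (at t)"
    by (simp add: DERIV_cong_ev[OF refl _ refl])
qed

lemma has_second_derivative_imp_has_derivative:
  assumes "has_second_derivative F D2 x"
  shows "\<exists>L. (F has_derivative L) (at x)"
  using assms unfolding has_second_derivative_def by (blast dest: eventually_nhds_x_imp_x)

text \<open>
  A function with a critical point at \<open>0\<close> grows at least quadratically where its second derivative is
  bounded below.  The second-order Taylor estimate is obtained by comparing \<open>t \<mapsto> F (t s)\<close> with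
  \<open>t \<mapsto> c \<parallel>s\<parallel>\<^sup>2 t\<^sup>2 / 2\<close>, so continuity of the second derivative is not required.
\<close>

lemma second_derivative_growth:
  fixes F :: "'b::real_normed_vector \<Rightarrow> real"
  assumes crit: "(F has_derivative (\<lambda>v. 0)) (at 0)"
    and D2: "\<And>y. norm y \<le> norm s \<Longrightarrow> \<exists>D2. has_second_derivative F D2 y \<and>
      c * (norm s)\<^sup>2 \<le> blinfun_apply (blinfun_apply D2 s) s"
  shows "c / 2 * (norm s)\<^sup>2 \<le> F s - F 0"
proof -
  define k where "k = c * (norm s)\<^sup>2"
  define g where "g t = frechet_derivative F (at (t *\<^sub>R s)) s" for t
  have D: "\<exists>d. (g has_real_derivative d) (at t) \<and> k \<le> d"
      "((\<lambda>t. F (t *\<^sub>R s)) has_real_derivative g t) (at t)" if "0 \<le> t" "t \<le> 1" for t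
  proof -
    have "norm (t *\<^sub>R s) \<le> norm s"
      using that by (simp add: mult_left_le_one_le)
    then obtain D2 where "has_second_derivative F D2 (t *\<^sub>R s)" "k \<le> blinfun_apply (blinfun_apply D2 s) s"
      using D2 unfolding k_def by blast
    then show "\<exists>d. (g has_real_derivative d) (at t) \<and> k \<le> d"
      "((\<lambda>t. F (t *\<^sub>R s)) has_real_derivative g t) (at t)"
      using has_second_derivative_along_ray[of F D2 t s] unfolding g_def by blast+
  qed
  have "g 0 = 0"
    using frechet_derivative_at[OF crit] by (simp add: g_def fun_eq_iff)
  have g: "k * t \<le> g t" if t: "0 \<le> t" "t \<le> 1" for t
  proof -
    have "g 0 - k * 0 \<le> g t - k * t"
    proof (rule DERIV_nonneg_imp_nondecreasing[OF t(1)])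
      fix x assume "0 \<le> x" "x \<le> t"
      then obtain d where "(g has_real_derivative d) (at x)" "k \<le> d"
        using D(1)[of x] t by auto
      then show "\<exists>y. ((\<lambda>x. g x - k * x) has_real_derivative y) (at x) \<and> 0 \<le> y"
        by (intro exI[of _ "d - k"]) (auto intro!: derivative_eq_intros)
    qed
    then show ?thesis
      using \<open>g 0 = 0\<close> by simp
  qed
  have "F (0 *\<^sub>R s) - k * 0\<^sup>2 / 2 \<le> F (1 *\<^sub>R s) - k * 1\<^sup>2 / 2"
  proof (rule DERIV_nonneg_imp_nondecreasing[of 0 1 "\<lambda>t. F (t *\<^sub>R s) - k * t\<^sup>2 / 2"])
    fix x :: real assume x: "0 \<le> x" "x \<le> 1"
    show "\<exists>y. ((\<lambda>t. F (t *\<^sub>R s) - k * t\<^sup>2 / 2) has_real_derivative y) (at x) \<and> 0 \<le> y"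
      using g[OF x]
      by (intro exI[of _ "g x - k * x"]) (auto intro!: derivative_eq_intros D(2)[OF x])
  qed simp
  then show ?thesis
    by (simp add: k_def)
qed

section \<open>Trapping of curves\<close>

text \<open>The times spent in \<open>V\<close> form a set that is both open and closed in the interval \<open>I\<close>.\<close>

lemma trapped_curve:
  fixes u :: "real \<Rightarrow> 'm::topological_space"
  assumes I: "is_interval I" and u: "continuous_on I u" and V: "open V" and K: "closed K" "V \<subseteq> K"
    and t: "t0 \<in> I" "u t0 \<in> V" "t \<in> I"
    and trap: "\<And>t. t \<in> I \<Longrightarrow> u t \<in> K \<Longrightarrow> u t \<in> V"
  shows "u t \<in> V"
proof -
  have "connected I"
    using I by (simp add: is_interval_connected)
  moreover have "openin (top_of_set I) (I \<inter> u -` V)"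
    using u V by (rule continuous_openin_preimage_gen)
  moreover have "closedin (top_of_set I) (I \<inter> u -` K)"
    using u K(1) by (rule continuous_closedin_preimage)
  moreover have "I \<inter> u -` V = I \<inter> u -` K"
    using K(2) trap by blast
  ultimately have "I \<inter> u -` V = {} \<or> I \<inter> u -` V = I"
    unfolding connected_clopen by metis
  then show ?thesis
    using t by blast
qed

lemma t3_open_neighbourhood:
  fixes z :: "'m::t3_space"
  assumes "open T" "z \<in> T"
  obtains W where "open W" "z \<in> W" "closure W \<subseteq> T"
proof -
  obtain U V where UV: "open U" "open V" "z \<in> U" "- T \<subseteq> V" "U \<inter> V = {}"
    using t3_space[of "- T" z] assms by (auto simp: closed_Compl)
  have "closure U \<subseteq> - V"
    using UV by (intro closure_minimal) auto
  then show thesis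
    using UV that[of U] by auto
qed

text \<open>
  A tube lemma for the compact set \<open>Q \<times> {0}\<close>: finitely many of the neighbourhoods with closure in
  \<open>T\<close> that regularity provides around the points \<open>f a 0\<close> suffice, and the closure of a finite
  union is the union of the closures.
\<close>

lemma thin_tube_closure:
  fixes f :: "'g::topological_space \<Rightarrow> 'b::real_normed_vector \<Rightarrow> 'm::t3_space"
  assumes Q: "compact Q" and r: "r > 0"
    and f: "continuous_on (Q \<times> ball 0 r) (\<lambda>(a, s). f a s)"
    and T: "open T" "\<And>a. a \<in> Q \<Longrightarrow> f a 0 \<in> T"
  obtains \<delta> where "0 < \<delta>" "\<delta> \<le> r" "closure {f a s | a s. a \<in> Q \<and> norm s < \<delta>} \<subseteq> T"
proof -
  have "\<exists>N d W. open N \<and> a \<in> N \<and> d > 0 \<and> closure W \<subseteq> T \<and>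
      (\<forall>b\<in>Q \<inter> N. \<forall>s. norm s < min d r \<longrightarrow> f b s \<in> W)" if a: "a \<in> Q" for a
  proof -
    obtain W where W: "open W" "f a 0 \<in> W" "closure W \<subseteq> T"
      using t3_open_neighbourhood[OF T(1) T(2)[OF a]] by blast
    obtain O' where O': "open O'" "O' \<inter> (Q \<times> ball 0 r) = (\<lambda>(a, s). f a s) -` W \<inter> (Q \<times> ball 0 r)"
      using f W(1) unfolding continuous_on_open_invariant by meson
    then have "(a, 0) \<in> O'"
      using a r W(2) by auto
    then obtain N Z where N: "open N" "open Z" "a \<in> N" "0 \<in> Z" "N \<times> Z \<subseteq> O'"
      using O'(1) by (metis open_prod_elim mem_Sigma_iff)
    obtain d where d: "d > 0" "ball 0 d \<subseteq> Z"
      using N(2,4) open_contains_ball by blast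
    have "f b s \<in> W" if "b \<in> Q \<inter> N" "norm s < min d r" for b s
    proof -
      have "(b, s) \<in> O' \<inter> (Q \<times> ball 0 r)"
        using that N(5) d(2) by (auto simp: subset_iff)
      then show ?thesis
        unfolding O'(2) by auto
    qed
    then show ?thesis
      using N(1,3) d(1) W(3) by blast
  qed
  then have "\<forall>a. \<exists>N d W. a \<in> Q \<longrightarrow> open N \<and> a \<in> N \<and> d > 0 \<and> closure W \<subseteq> T \<and>
      (\<forall>b\<in>Q \<inter> N. \<forall>s. norm s < min d r \<longrightarrow> f b s \<in> W)"
    by meson
  then obtain N d W where "\<forall>a. a \<in> Q \<longrightarrow> open (N a) \<and> a \<in> N a \<and> d a > 0 \<and> closure (W a) \<subseteq> T \<and>
      (\<forall>b\<in>Q \<inter> N a. \<forall>s. norm s < min (d a) r \<longrightarrow> f b s \<in> W a)"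
    unfolding choice_iff by blast
  then have h: "open (N a) \<and> a \<in> N a \<and> d a > 0 \<and> closure (W a) \<subseteq> T \<and>
      (\<forall>b\<in>Q \<inter> N a. \<forall>s. norm s < min (d a) r \<longrightarrow> f b s \<in> W a)" if "a \<in> Q" for a
    using that by simp
  have N: "open (N a)" "a \<in> N a" and d: "d a > 0" and W: "closure (W a) \<subseteq> T" if "a \<in> Q" for a
    using h[OF that] by simp_all
  have NW: "f b s \<in> W a" if "a \<in> Q" "b \<in> Q \<inter> N a" "norm s < min (d a) r" for a b s
    using h[OF that(1)] that(2,3) by simp
  obtain F where F: "F \<subseteq> Q" "finite F" "Q \<subseteq> (\<Union>a\<in>F. N a)"
    using compactE_image[OF Q, of Q N] N by blast
  define \<delta> where "\<delta> = Min (insert r (d ` F))"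
  have "0 < \<delta>"
    using F(1,2) d r unfolding \<delta>_def by (subst Min_gr_iff) auto
  have "\<delta> \<le> r" and \<delta>: "\<And>a. a \<in> F \<Longrightarrow> \<delta> \<le> d a"
    using F(2) unfolding \<delta>_def by (auto intro: Min_le)
  have "{f a s | a s. a \<in> Q \<and> norm s < \<delta>} \<subseteq> (\<Union>a\<in>F. W a)"
  proof clarify
    fix b and s :: 'b assume b: "b \<in> Q" "norm s < \<delta>"
    then obtain a where a: "a \<in> F" "b \<in> N a"
      using F(3) by blast
    then have "f b s \<in> W a"
      using NW[of a b s] F(1) b \<delta>[OF a(1)] \<open>\<delta> \<le> r\<close> by auto
    then show "f b s \<in> (\<Union>a\<in>F. W a)"
      using a(1) by blast
  qed
  also have "\<dots> \<subseteq> (\<Union>a\<in>F. closure (W a))"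
    using closure_subset by blast
  finally have "closure {f a s | a s. a \<in> Q \<and> norm s < \<delta>} \<subseteq> (\<Union>a\<in>F. closure (W a))"
    by (rule closure_minimal) (simp add: F(2) closed_UN)
  also have "\<dots> \<subseteq> T"
    using W F(1) by blast
  finally show thesis
    using that \<open>0 < \<delta>\<close> \<open>\<delta> \<le> r\<close> by blast
qed

section \<open>The slice through the relative equilibrium\<close>

text \<open>
  A critical point on the manifold stays critical after composition with the map \<open>s \<mapsto> f a s\<close>, which
  is differentiable at \<open>0\<close> in charts because it is the restriction of a smooth map to \<open>{a} \<times> ball 0 r\<close>.
\<close>

lemma critical_point_slice:
  fixes A :: "('m::t3_space, 'e::banach) chart set"
    and AG :: "('g::t3_space, 'l::banach) chart set"
    and f :: "'g \<Rightarrow> 'b::banach \<Rightarrow> 'm"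
  assumes M: "banach_manifold A" and G: "banach_manifold AG"
    and f: "smooth_map_on (prod_atlas AG model_atlas) A (Q \<times> ball 0 r) (\<lambda>(a, s). f a s)"
    and r: "0 < r" and a: "a \<in> Q" and h: "critical_point A h (f a 0)"
  shows "((\<lambda>s. h (f a s)) has_derivative (\<lambda>v. 0)) (at 0)"
proof -
  obtain c where c: "c \<in> A" "f a 0 \<in> fst c"
    using chart_exists[OF M, of "f a 0"] unfolding charts_at_def by blast
  obtain \<kappa> where \<kappa>: "\<kappa> \<in> AG" "a \<in> fst \<kappa>"
    using chart_exists[OF G, of a] unfolding charts_at_def by blast
  let ?b = "(fst \<kappa> \<times> UNIV, map_prod (snd \<kappa>) id) :: ('g \<times> 'b, 'l \<times> 'b) chart"
  let ?\<gamma> = "\<lambda>s::'b. (a, s)"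
  have \<gamma>lim: "(?\<gamma> \<longlongrightarrow> ?\<gamma> 0) (nhds 0)"
    by (intro tendsto_Pair tendsto_const) (simp add: filterlim_ident)
  have ball: "\<forall>\<^sub>F s in nhds 0. ?\<gamma> s \<in> Q \<times> ball 0 r"
    using eventually_nhds_in_open[of "ball (0::'b) r" 0] r a by (auto elim: eventually_mono)
  have "((\<lambda>s. (snd \<kappa> a, s)) has_derivative (\<lambda>h. (0, h))) (at (0::'b))"
    by (auto intro!: derivative_eq_intros)
  then have \<gamma>': "(snd ?b \<circ> ?\<gamma>) differentiable (at 0)"
    unfolding differentiable_def by (intro exI[of _ "\<lambda>h. (0, h)"]) (simp add: comp_def)
  have "(snd c \<circ> (\<lambda>(a, s). f a s) \<circ> ?\<gamma>) differentiable (at 0)"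
  proof (rule smooth_map_on_compose_differentiable[OF f _ _ _ c(1) _ _ _ \<gamma>lim ball \<gamma>'])
    show "?b \<in> prod_atlas AG model_atlas"
      using prod_atlasI[OF \<kappa>(1), of "(UNIV, id)" model_atlas] by (simp add: model_atlas_def)
    show "open (fst ?b)"
      using chart_facts(1)[OF G \<kappa>(1)] by (simp add: open_Times)
    show "inj_on (snd ?b) (fst ?b)"
      using map_prod_inj_on[OF chart_facts(5)[OF G \<kappa>(1)] inj_on_id] by simp
  qed (use c \<kappa> chart_facts(1)[OF M c(1)] in auto)
  then obtain L where L: "((\<lambda>s. snd c (f a s)) has_derivative L) (at 0)"
    unfolding differentiable_def by (auto simp: comp_def)
  have "((h \<circ> chart_inv c) has_derivative (\<lambda>v. 0)) (at (snd c (f a 0)))"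
    using h c unfolding critical_point_def charts_at_def by blast
  from has_derivative_compose[OF L this]
  have d: "((\<lambda>s. h (chart_inv c (snd c (f a s)))) has_derivative (\<lambda>v. 0)) (at 0)"
    by simp
  have "continuous_on (ball 0 r) (\<lambda>s. (\<lambda>(a, s). f a s) (a, s))"
    by (rule continuous_on_compose2[OF smooth_map_on_imp_continuous_on[OF f]])
       (use a in \<open>auto intro!: continuous_intros\<close>)
  then have "open (ball 0 r \<inter> f a -` fst c)"
    using chart_facts(1)[OF M c(1)] by (intro continuous_open_preimage) auto
  then show ?thesis
    by (rule has_derivative_transform_within_open[OF d])
       (use c r chart_facts(6)[OF M c(1)] in auto)
qed

text \<open>
  No differentiability of the penalty \<open>p\<close> is assumed: \<open>\<sigma> p\<close> is differentiable at \<open>x\<close> as a difference,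
  and its derivative vanishes because \<open>p\<close> has a minimum there.
\<close>

lemma has_derivative_zero_penalty:
  fixes h :: "'b::real_normed_vector \<Rightarrow> real"
  assumes h: "(h has_derivative (\<lambda>v. 0)) (at x)"
    and F: "((\<lambda>s. h s + \<sigma> * p s) has_derivative L) (at x)"
    and p: "\<And>s. 0 \<le> p s" "p x = 0"
  shows "L = (\<lambda>v. 0)"
proof -
  have "((\<lambda>s. (h s + \<sigma> * p s) - h s) has_derivative (\<lambda>v. L v - 0)) (at x)"
    by (rule has_derivative_diff[OF F h])
  then have d: "((\<lambda>s. \<sigma> * p s) has_derivative L) (at x)"
    by simp
  have "(\<forall>y\<in>UNIV. \<sigma> * p y \<le> \<sigma> * p x) \<or> (\<forall>y\<in>UNIV. \<sigma> * p x \<le> \<sigma> * p y)"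
    using p by (cases "\<sigma> \<ge> 0") (auto simp: mult_nonpos_nonneg)
  then show ?thesis
    using differential_zero_maxmin[OF UNIV_I open_UNIV d] by blast
qed

text \<open>
  If \<open>P\<close> is the squared norm of the slice variable, then on a tube \<open>T\<close> covered by local sections of \<open>(a, s) \<mapsto> f a s\<close> it is
  locally the composition of a smooth map with a continuous one.
\<close>

lemma continuous_on_tube_radius:
  assumes "\<And>z. z \<in> T \<Longrightarrow> \<exists>W L. open W \<and> z \<in> W \<and> smooth_map_on A (prod_atlas AG model_atlas) W L \<and>
      (\<forall>w\<in>W. L w \<in> Q \<times> S \<and> f (fst (L w)) (snd (L w)) = w)"
    and P: "\<And>a s. a \<in> Q \<Longrightarrow> s \<in> S \<Longrightarrow> P (f a s) = (norm s)\<^sup>2"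
  shows "continuous_on T (P :: 'm::topological_space \<Rightarrow> real)"
  unfolding continuous_on_def
proof
  fix z assume "z \<in> T"
  then obtain W L where W: "open W" "z \<in> W" and L: "smooth_map_on A (prod_atlas AG model_atlas) W L"
    and LW: "\<And>w. w \<in> W \<Longrightarrow> L w \<in> Q \<times> S \<and> f (fst (L w)) (snd (L w)) = w"
    using assms(1)[of z] by auto
  have eq: "P w = (norm (snd (L w)))\<^sup>2" if "w \<in> W" for w
    using P[of "fst (L w)" "snd (L w)"] LW[OF that] by (auto simp: mem_Times_iff)
  have "continuous_on W (\<lambda>w. (norm (snd (L w)))\<^sup>2)"
    by (intro continuous_intros smooth_map_on_imp_continuous_on[OF L])
  then have "continuous_on W P"
    using eq by (simp cong: continuous_on_cong)
  then have "(P \<longlongrightarrow> P z) (at z)"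
    using W unfolding continuous_on_def by (metis at_within_open)
  then show "(P \<longlongrightarrow> P z) (at z within T)"
    by (rule filterlim_mono) (auto simp: at_le)
qed

section \<open>Stability of tubes\<close>

text \<open>
  The sets \<open>{z \<in> T. P z < \<eta>\<^sup>2}\<close> and \<open>{z \<in> T. P z \<le> \<eta>\<^sup>2}\<close> are open and, for small \<open>\<eta>\<close>, closed in the
  whole space.  A curve of energy below \<open>c \<eta>\<^sup>2\<close> cannot meet their difference, so it stays in the first set once
  it is there, whatever the direction of time.
\<close>

lemma tube_stability:
  fixes f :: "'g::topological_space \<Rightarrow> 'b::real_normed_vector \<Rightarrow> 'm::t3_space"
    and P E :: "'m \<Rightarrow> real"
  assumes Q: "compact Q" and r: "0 < r"
    and f: "continuous_on (Q \<times> ball 0 r) (\<lambda>(a, s). f a s)"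
    and T: "open T" "T = {f a s | a s. a \<in> Q \<and> norm s < r}"
    and P: "continuous_on T P" "\<And>a s. a \<in> Q \<Longrightarrow> norm s < r \<Longrightarrow> P (f a s) = (norm s)\<^sup>2"
    and E: "continuous_on UNIV E" "\<And>a. a \<in> Q \<Longrightarrow> E (f a 0) = 0"
    and growth: "0 < c" "0 < r0"
      "\<And>a s. a \<in> Q \<Longrightarrow> norm s < r \<Longrightarrow> norm s < r0 \<Longrightarrow> c * (norm s)\<^sup>2 \<le> E (f a s)"
    and \<epsilon>: "0 < \<epsilon>"
  shows "\<exists>U. open U \<and> (\<lambda>a. f a 0) ` Q \<subseteq> U \<and>
      (\<forall>I (u :: real \<Rightarrow> 'm). is_interval I \<and> continuous_on I u \<and> (\<forall>s\<in>I. \<forall>t\<in>I. E (u s) = E (u t)) \<and> 0 \<in> I \<and> u 0 \<in> U \<longrightarrow>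
        (\<forall>t\<in>I. u t \<in> T \<and> P (u t) < \<epsilon>))"
proof -
  have center: "f a 0 \<in> T" if "a \<in> Q" for a
    unfolding T(2) mem_Collect_eq using that r by (intro exI[of _ a] exI[of _ 0]) simp
  obtain \<delta> where \<delta>: "0 < \<delta>" "\<delta> \<le> r" "closure {f a s | a s. a \<in> Q \<and> norm s < \<delta>} \<subseteq> T"
    using thin_tube_closure[OF Q r f T(1) center] by blast
  (* The factor 1/2 makes all three inequalities strict; \<eta> < \<delta> gives closedness, \<eta> < r0 the growth
     estimate, and \<eta> < sqrt \<epsilon> ensures \<eta>\<^sup>2 < \<epsilon>. *)
  define \<eta> where "\<eta> = min (min \<delta> r0) (sqrt \<epsilon>) / 2"
  have \<eta>: "0 < \<eta>" "\<eta> < \<delta>" "\<eta> < r0" "\<eta> < sqrt \<epsilon>"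
    using \<delta>(1) growth(2) \<epsilon> by (auto simp: \<eta>_def min_def)
  have "\<eta>\<^sup>2 < (sqrt \<epsilon>)\<^sup>2"
    using \<eta>(1,4) by (intro power_strict_mono) auto
  then have \<eta>\<epsilon>: "\<eta>\<^sup>2 < \<epsilon>"
    using \<epsilon> by simp
  define Z where "Z = {f a s | a s. a \<in> Q \<and> norm s < \<delta>}"
  define V where "V = {z \<in> T. P z < \<eta>\<^sup>2}"
  define K where "K = {z \<in> T. P z \<le> \<eta>\<^sup>2}"
  define U where "U = V \<inter> {z. E z < c * \<eta>\<^sup>2}"
  have K_elim: "\<exists>a s. a \<in> Q \<and> norm s \<le> \<eta> \<and> norm s < r \<and> z = f a s" if z: "z \<in> K" for z
  proof -
    obtain a s where as: "a \<in> Q" "norm s < r" "z = f a s"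
      using z unfolding K_def T(2) by blast
    then have "(norm s)\<^sup>2 \<le> \<eta>\<^sup>2"
      using z P(2)[OF as(1,2)] by (simp add: K_def)
    then have "norm s \<le> \<eta>"
      by (rule power2_le_imp_le) (simp add: \<eta>(1) less_imp_le)
    then show ?thesis
      using as by blast
  qed
  have "V = T \<inter> P -` {..<\<eta>\<^sup>2}"
    by (auto simp: V_def)
  then have "open V"
    using continuous_open_preimage[OF P(1) T(1) open_lessThan] by simp
  have "K \<subseteq> Z"
  proof
    fix z assume "z \<in> K"
    then obtain a s where "a \<in> Q" "norm s \<le> \<eta>" "z = f a s"
      using K_elim by blast
    moreover from this have "norm s < \<delta>"
      using \<eta>(2) by linarith
    ultimately show "z \<in> Z"
      unfolding Z_def by blast
  qed
  then have "K = closure Z \<inter> P -` {..\<eta>\<^sup>2}"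
    using \<delta>(3) closure_subset[of Z] by (auto simp: K_def Z_def[symmetric])
  moreover have "continuous_on (closure Z) P"
    using \<delta>(3) P(1) continuous_on_subset unfolding Z_def by blast
  ultimately have "closed K"
    using continuous_closed_preimage[of "closure Z" P "{..\<eta>\<^sup>2}"] by simp
  have "open {z. E z < c * \<eta>\<^sup>2}"
    using E(1) by (intro open_Collect_less) auto
  then have "open U"
    unfolding U_def using \<open>open V\<close> by (rule open_Int[rotated])
  have orbit: "(\<lambda>a. f a 0) ` Q \<subseteq> U"
  proof (rule image_subsetI)
    fix a assume a: "a \<in> Q"
    have "P (f a 0) = 0"
      using P(2)[OF a, of 0] r by simp
    then show "f a 0 \<in> U"
      using center[OF a] E(2)[OF a] \<eta>(1) growth(1) by (simp add: U_def V_def)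
  qed
  have stay: "u t \<in> T \<and> P (u t) < \<epsilon>"
    if I: "is_interval I" "continuous_on I u" and Eu: "\<And>s t. s \<in> I \<Longrightarrow> t \<in> I \<Longrightarrow> E (u s) = E (u t)"
      and u0: "0 \<in> I" "u 0 \<in> U" and t: "t \<in> I" for I t
    and u :: "real \<Rightarrow> 'm"
  proof -
    have trap: "u t \<in> V" if t: "t \<in> I" "u t \<in> K" for t
    proof -
      obtain a s where as: "a \<in> Q" "norm s \<le> \<eta>" "norm s < r" "u t = f a s"
        using K_elim[OF t(2)] by blast
      have "c * (norm s)\<^sup>2 \<le> E (u t)"
        using growth(3)[OF as(1,3)] as(2,4) \<eta>(3) by simp
      also have "\<dots> < c * \<eta>\<^sup>2"
        using u0(2) Eu[OF t(1) u0(1)] by (simp add: U_def)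
      finally have "(norm s)\<^sup>2 < \<eta>\<^sup>2"
        using growth(1) by simp
      then show ?thesis
        using t(2) P(2)[OF as(1,3)] as(4) by (simp add: V_def K_def)
    qed
    have VK: "V \<subseteq> K"
      by (auto simp: V_def K_def)
    have u0V: "u 0 \<in> V"
      using u0(2) by (simp add: U_def)
    have "u t \<in> V"
      by (rule trapped_curve[OF I \<open>open V\<close> \<open>closed K\<close> VK u0(1) u0V t]) (rule trap)
    then show ?thesis
      using \<eta>\<epsilon> by (simp add: V_def)
  qed
  show ?thesis
  proof (intro exI[of _ U] conjI[OF \<open>open U\<close> conjI[OF orbit]] allI impI ballI)
    fix I and u :: "real \<Rightarrow> 'm" and t
    assume h: "is_interval I \<and> continuous_on I u \<and> (\<forall>s\<in>I. \<forall>t\<in>I. E (u s) = E (u t)) \<and> 0 \<in> I \<and> u 0 \<in> U"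
      and t: "t \<in> I"
    show "u t \<in> T \<and> P (u t) < \<epsilon>"
      by (rule stay[of I]) (use h t in blast)+
  qed
qed

section \<open>The energy-momentum-Casimir method\<close>

lemma coAd_op_diff: "coAd_op G \<kappa> a (\<alpha> - \<beta>) = coAd_op G \<kappa> a \<alpha> - coAd_op G \<kappa> a \<beta>"
  unfolding coAd_op_def by (rule blinfun_eqI) (simp add: blinfun.diff_left)

theorem theorem4:
  fixes A :: "('m::t3_space, 'e::banach) chart set"
    and \<Lambda> :: "('m, 'e) chart \<Rightarrow> 'm \<Rightarrow> ('e \<Rightarrow>\<^sub>L real) \<Rightarrow>\<^sub>L 'e"
    and G :: "'g::t3_space monoid"
    and AG :: "('g, 'l::banach) chart set"
    and \<kappa> :: "('g, 'l) chart"
    and \<Phi> :: "'g \<Rightarrow> 'm \<Rightarrow> 'm"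
    and J :: "'m \<Rightarrow> 'l \<Rightarrow>\<^sub>L real"
    and H :: "'m \<Rightarrow> real"
    and ze :: 'm
    and \<xi> :: 'l
    and \<mu> :: "'l \<Rightarrow>\<^sub>L real"
    and C :: "'m \<Rightarrow> 'v::real_inner"
    and N :: "'l \<Rightarrow> real"
    and Nd :: "('l \<Rightarrow>\<^sub>L real) \<Rightarrow> real"
    and \<rho> :: "'g \<Rightarrow> 'b::banach \<Rightarrow> 'b"
    and r :: real
    and \<Psi> :: "('g \<times> 'b) set \<Rightarrow> 'm"
    and lam :: "'v \<Rightarrow>\<^sub>L real"
    and \<sigma> :: real
    and P :: "'m \<Rightarrow> real"
  defines "G\<mu> \<equiv> coAd_isotropy G \<kappa> \<mu>"
    and "Gz \<equiv> isotropy \<Phi> ze"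
  defines "XH \<equiv> hamiltonian_vf A \<Lambda> H"
    and "\<psi> \<equiv> slice_embedding G (G\<mu> \<inter> Gz) \<rho> \<Psi>"
    and "T \<equiv> tube G G\<mu> (G\<mu> \<inter> Gz) \<rho> r \<Psi>"
  assumes "banach_manifold A" and "poisson_structure A \<Lambda>"
    and "lie_group G AG" and "compact (UNIV :: 'g set)" and "\<kappa> \<in> charts_at AG \<one>\<^bsub>G\<^esub>"
    and "smooth_action G AG A \<Phi>" and "canonical_action A \<Lambda> \<Phi>"
    and "equivariant_momentum_map G \<kappa> A \<Lambda> \<Phi> J"
    and "\<forall>z. mdifferentiable_at A H z" and "\<forall>a z. H (\<Phi> a z) = H z"
    and "XH ze = inf_generator G \<kappa> A \<Phi> \<xi> ze"
    and "\<mu> = J ze"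
    and "\<forall>a\<in>G\<mu>. \<forall>z. C (\<Phi> a z) = C z"
    and "\<forall>I u. integral_curve A XH I u \<longrightarrow> (\<forall>s\<in>I. \<forall>t\<in>I. C (u s) = C (u t))"
    and "is_norm N" and "\<forall>a\<in>G\<mu>. \<forall>\<zeta>. N (blinfun_apply (Ad_op G \<kappa> a) \<zeta>) = N \<zeta>"
    and "is_norm Nd" and "\<forall>a\<in>G\<mu>. \<forall>\<alpha>. Nd (coAd_op G \<kappa> a \<alpha>) = Nd \<alpha>"
    and "\<forall>\<alpha> \<zeta>. blinfun_apply \<alpha> \<zeta> \<le> Nd \<alpha> * N \<zeta>"
    and "slice_through G AG A \<Phi> G\<mu> ze \<rho> r \<Psi>"
    and "continuous_on UNIV H" and "continuous_on UNIV J" and "continuous_on UNIV C"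
    and "critical_point A (aug_ham H J C \<xi> lam) ze"
    and "\<exists>c>0. \<forall>\<^sub>F s in nhds 0. \<exists>D2.
           has_second_derivative (aug_ham_pen Nd H J C ze \<xi> lam \<sigma> \<circ> \<psi>) D2 s \<and>
           (\<forall>v\<in>ball 0 r. c * (norm v)\<^sup>2 \<le> blinfun_apply (blinfun_apply D2 v) v)"
    and "Gz \<subseteq> Ad_isotropy G \<kappa> \<xi>"
    and "\<forall>a\<in>G\<mu>. \<forall>z\<in>T. P (\<Phi> a z) = P z" and "\<forall>s\<in>ball 0 r. P (\<psi> s) = (norm s)\<^sup>2"
  shows "\<forall>\<epsilon>>0. \<exists>U. open U \<and> (\<lambda>a. \<Phi> a ze) ` G\<mu> \<subseteq> U \<and>
           (\<forall>I u. integral_curve A XH I u \<and> 0 \<in> I \<and> u 0 \<in> U \<longrightarrow>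
              (\<forall>t\<in>I. 0 \<le> t \<longrightarrow> u t \<in> T \<and> P (u t) < \<epsilon>))"
proof -
  note M = assms(6) and PS = assms(7) and LG = assms(8)[unfolded lie_group_def]
    and \<kappa> = assms(10) and act = assms(11) and mom = assms(13)
    and diffH = assms(14)[rule_format] and invH = assms(15)[rule_format]
    and \<mu> = assms(17) and invC = assms(18)[rule_format] and flowC = assms(19)[rule_format]
    and N = assms(20) and Nd = assms(22) and invNd = assms(23)[rule_format] and dual = assms(24)[rule_format]
    and S = assms(25)[unfolded slice_through_def Let_def, folded Gz_def, folded T_def]
    and invP = assms(32)[rule_format] and P\<psi> = assms(33)[rule_format]
  (* f a s is the point of the manifold that corresponds to the class [a, s]. *)
  define f where "f a s = \<Psi> (assoc_class G (G\<mu> \<inter> Gz) \<rho> a s)" for a s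
  let ?one = "\<one>\<^bsub>G\<^esub>"
  note grp = LG[THEN conjunct1] and carr = LG[THEN conjunct2, THEN conjunct1]
    and MG = LG[THEN conjunct2, THEN conjunct2, THEN conjunct1]
    and fin = LG[THEN conjunct2, THEN conjunct2, THEN conjunct2, THEN conjunct1]
  have \<Phi>one: "\<Phi> ?one z = z" for z
    using act unfolding smooth_action_def by simp
  have \<Phi>smooth: "smooth_map_on (prod_atlas AG A) A UNIV (\<lambda>(a, z). \<Phi> a z)"
    using act unfolding smooth_action_def by (elim conjE)
  have eqv: "J (\<Phi> a z) = coAd_op G \<kappa> a (J z)" for a z
    using mom unfolding equivariant_momentum_map_def by simp

  text \<open>By equivariance, \<open>G\<mu>\<close> is the closed set of all \<open>a\<close> with \<open>J (\<Phi> a ze) = \<mu>\<close>.\<close>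
  have Q_iff: "a \<in> G\<mu> \<longleftrightarrow> J (\<Phi> a ze) = \<mu>" for a
    by (simp add: G\<mu>_def isotropy_def eqv \<mu>)
  have coAd\<mu>: "coAd_op G \<kappa> a \<mu> = \<mu>" if "a \<in> G\<mu>" for a
    using that by (simp add: G\<mu>_def isotropy_def)
  have one: "?one \<in> G\<mu>"
    unfolding Q_iff by (simp add: \<Phi>one \<mu>)
  have "continuous_on UNIV (\<lambda>a. (\<lambda>(a, z). \<Phi> a z) (a, ze))"
    by (rule continuous_on_compose2[OF smooth_map_on_imp_continuous_on[OF \<Phi>smooth]])
       (auto intro!: continuous_intros)
  then have "continuous_on UNIV (\<lambda>a. J (\<Phi> a ze))"
    by (intro continuous_on_compose2[OF assms(27)]) auto
  then have "closed {a. J (\<Phi> a ze) = \<mu>}"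
    by (intro closed_Collect_eq) auto
  moreover have "G\<mu> = {a. J (\<Phi> a ze) = \<mu>}"
    using Q_iff by blast
  ultimately have Q: "compact G\<mu>"
    using compact_Int_closed[OF assms(9)] by simp

  note r = S[THEN conjunct1] and T = S[THEN conjunct2, THEN conjunct2, THEN conjunct1]
    and S' = S[THEN conjunct2, THEN conjunct2, THEN conjunct2, THEN conjunct2]
  note eqvS = S'[THEN conjunct1] and center = S'[THEN conjunct2, THEN conjunct1]
    and smooth = S'[THEN conjunct2, THEN conjunct2, THEN conjunct1]
    and lift = S'[THEN conjunct2, THEN conjunct2, THEN conjunct2]
  note center = center[folded f_def] and smooth = smooth[folded f_def] and lift = lift[folded f_def, rule_format]
  have f_\<Phi>: "f a s = \<Phi> a (f ?one s)" if "a \<in> G\<mu>" "norm s < r" for a s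
  proof -
    have "a \<otimes>\<^bsub>G\<^esub> ?one = a"
      using group.is_monoid[OF grp] carr by (simp add: monoid.r_one)
    then show ?thesis
      using eqvS[rule_format, OF that(1) one, of s] that(2) by (simp add: f_def)
  qed
  have T_eq: "T = {f a s | a s. a \<in> G\<mu> \<and> norm s < r}"
    unfolding T_def tube_def assoc_bundle_def f_def by auto
  have \<psi>: "\<psi> s = f ?one s" for s
    by (simp add: \<psi>_def slice_embedding_def f_def)
  have P_f: "P (f a s) = (norm s)\<^sup>2" if as: "a \<in> G\<mu>" "norm s < r" for a s
  proof -
    have "f ?one s \<in> T"
      unfolding T_eq using one as(2) by blast
    then show ?thesis
      using f_\<Phi>[OF as] invP[OF as(1)] P\<psi>[of s] as(2) by (simp add: \<psi>)
  qed
  have contP: "continuous_on T P"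
    by (rule continuous_on_tube_radius[where f = f and S = "ball 0 r" and Q = G\<mu>, OF lift])
       (simp_all add: P_f)

  text \<open>
    The energy \<open>E\<close> is built from conserved quantities and vanishes on the orbit of \<open>ze\<close>; on the tube
    it dominates the increase of the penalised augmented Hamiltonian along the slice.
  \<close>
  let ?pen = "penalty Nd J C ze"
  define E where "E z = \<bar>H z - H ze\<bar> + Nd (J z - \<mu>) * N \<xi> +
      \<bar>blinfun_apply lam (C z - C ze)\<bar> + \<bar>\<sigma>\<bar> * ?pen z" for z
  (* J is continuous for the operator norm, so Nd must be compared with it. *)
  obtain B where B: "finite B" "span B = (UNIV :: 'l set)"
    using fin by blast
  obtain k where k: "k \<ge> 0" "\<And>\<alpha>. Nd \<alpha> \<le> k * norm \<alpha>"
    using is_norm_dual_bound[OF Nd B] by blast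
  have contNd: "continuous_on UNIV (\<lambda>z. Nd (J z - J ze))"
    by (rule continuous_on_compose2[OF is_norm_continuous[OF Nd k]])
       (auto intro!: continuous_intros assms(27))
  have contE: "continuous_on UNIV E"
    unfolding E_def penalty_def \<mu>
    by (intro continuous_intros contNd assms(26) assms(28))
  have Nd0: "Nd 0 = 0"
    using Nd unfolding is_norm_def by simp
  have E_orbit: "E (f a 0) = 0" if a: "a \<in> G\<mu>" for a
  proof -
    have "f a 0 = \<Phi> a ze"
      using f_\<Phi>[OF a, of 0] r center by simp
    moreover have "J (\<Phi> a ze) = \<mu>"
      using a Q_iff by simp
    ultimately show ?thesis
      by (simp add: E_def penalty_def invH invC[OF a] \<mu>[symmetric] Nd0)
  qed
  have E_flow: "E (u s) = E (u t)" if u: "integral_curve A XH I u" and st: "s \<in> I" "t \<in> I" for I u s t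
  proof -
    have "H (u s) = H (u t)"
      using hamiltonian_conserved[OF M PS diffH u[unfolded XH_def] st] .
    moreover have "J (u s) = J (u t)"
      using momentum_conserved[OF M PS MG act \<kappa> mom diffH invH u[unfolded XH_def] st] .
    moreover have "C (u s) = C (u t)"
      using flowC[OF u st] .
    ultimately show ?thesis
      by (simp add: E_def penalty_def)
  qed
  let ?F = "\<lambda>s. aug_ham_pen Nd H J C ze \<xi> lam \<sigma> (f ?one s)"
  have pen_nonneg: "0 \<le> ?pen z" for z
    by (simp add: penalty_def)
  have pen_ze: "?pen ze = 0"
    by (simp add: penalty_def Nd0)
  have E_ge: "?F s - ?F 0 \<le> E (f a s)" if as: "a \<in> G\<mu>" "norm s < r" for a s
  proof -
    let ?w = "f ?one s" and ?z = "f a s"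
    have z: "?z = \<Phi> a ?w"
      by (rule f_\<Phi>[OF as])
    have "J ?z - \<mu> = coAd_op G \<kappa> a (J ?w - \<mu>)"
      using coAd\<mu>[OF as(1)] by (simp add: z eqv coAd_op_diff)
    then have NJ: "Nd (J ?z - \<mu>) = Nd (J ?w - \<mu>)"
      using invNd[OF as(1)] by simp
    have HC: "H ?z = H ?w" "C ?z = C ?w"
      by (simp_all add: z invH invC[OF as(1)])
    have pen: "?pen ?z = ?pen ?w"
      using NJ HC by (simp add: penalty_def \<mu>)
    have "blinfun_apply (- (J ?w - \<mu>)) \<xi> \<le> Nd (- (J ?w - \<mu>)) * N \<xi>"
      by (rule dual)
    then have "- (blinfun_apply (J ?w) \<xi> - blinfun_apply \<mu> \<xi>) \<le> Nd (J ?z - \<mu>) * N \<xi>"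
      unfolding is_norm_minus[OF Nd] NJ by (simp add: blinfun.diff_left blinfun.minus_left)
    moreover have "blinfun_apply lam (C ?w) - blinfun_apply lam (C ze) \<le> \<bar>blinfun_apply lam (C ?z - C ze)\<bar>"
      by (simp add: HC blinfun.diff_right)
    moreover have "\<sigma> * ?pen ?w \<le> \<bar>\<sigma>\<bar> * ?pen ?z"
      unfolding pen by (intro mult_right_mono pen_nonneg) simp
    moreover have "H ?w - H ze \<le> \<bar>H ?z - H ze\<bar>"
      by (simp add: HC)
    ultimately show ?thesis
      unfolding E_def aug_ham_pen_def aug_ham_def center pen_ze \<mu>[symmetric] by simp
  qed

  obtain c where c: "0 < c" and ev: "\<forall>\<^sub>F s in nhds 0. \<exists>D2.
       has_second_derivative ?F D2 s \<and> (\<forall>v\<in>ball 0 r. c * (norm v)\<^sup>2 \<le> blinfun_apply (blinfun_apply D2 v) v)"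
    using assms(30) unfolding comp_def \<psi> by blast
  obtain L where L: "(?F has_derivative L) (at 0)"
    using eventually_nhds_x_imp_x[OF ev] has_second_derivative_imp_has_derivative by blast
  have crit: "((\<lambda>s. aug_ham H J C \<xi> lam (f ?one s)) has_derivative (\<lambda>v. 0)) (at 0)"
    by (rule critical_point_slice[OF M MG smooth r one]) (simp add: center assms(29))
  have "L = (\<lambda>v. 0)"
    by (rule has_derivative_zero_penalty[OF crit L[unfolded aug_ham_pen_def] pen_nonneg])
       (simp add: center pen_ze)
  with L have crit0: "(?F has_derivative (\<lambda>v. 0)) (at 0)"
    by simp
  obtain r0 where r0: "0 < r0" and D2: "\<And>y. norm y < r0 \<Longrightarrow> \<exists>D2.
       has_second_derivative ?F D2 y \<and> (\<forall>v\<in>ball 0 r. c * (norm v)\<^sup>2 \<le> blinfun_apply (blinfun_apply D2 v) v)"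
    using ev unfolding eventually_nhds_metric dist_0_norm dist_commute[of _ 0] by blast
  have growth: "c / 2 * (norm s)\<^sup>2 \<le> E (f a s)" if "a \<in> G\<mu>" "norm s < r" "norm s < r0" for a s
  proof -
    have "c / 2 * (norm s)\<^sup>2 \<le> ?F s - ?F 0"
    proof (rule second_derivative_growth[OF crit0])
      fix y :: 'b assume "norm y \<le> norm s"
      then have "norm y < r0"
        using that(3) by simp
      from D2[OF this] show "\<exists>D2. has_second_derivative ?F D2 y \<and>
          c * (norm s)\<^sup>2 \<le> blinfun_apply (blinfun_apply D2 s) s"
        using that(2) by auto
    qed
    then show ?thesis
      using E_ge[OF that(1,2)] by linarith
  qed

  show ?thesis
  proof (intro allI impI)
    fix \<epsilon> :: real assume \<epsilon>: "0 < \<epsilon>"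
    have "\<exists>U. open U \<and> (\<lambda>a. f a 0) ` G\<mu> \<subseteq> U \<and>
        (\<forall>I (u :: real \<Rightarrow> 'm). is_interval I \<and> continuous_on I u \<and> (\<forall>s\<in>I. \<forall>t\<in>I. E (u s) = E (u t)) \<and>
          0 \<in> I \<and> u 0 \<in> U \<longrightarrow> (\<forall>t\<in>I. u t \<in> T \<and> P (u t) < \<epsilon>))"
      by (rule tube_stability[OF Q r smooth_map_on_imp_continuous_on[OF smooth] T T_eq contP _ contE _
            half_gt_zero[OF c] r0 _ \<epsilon>]) (rule P_f E_orbit growth; assumption)+
    then obtain U where U: "open U" "(\<lambda>a. f a 0) ` G\<mu> \<subseteq> U"
      and stable: "\<forall>I (u :: real \<Rightarrow> 'm). is_interval I \<and> continuous_on I u \<and>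
        (\<forall>s\<in>I. \<forall>t\<in>I. E (u s) = E (u t)) \<and> 0 \<in> I \<and> u 0 \<in> U \<longrightarrow> (\<forall>t\<in>I. u t \<in> T \<and> P (u t) < \<epsilon>)"
      by (elim exE conjE)
    have "(\<lambda>a. \<Phi> a ze) ` G\<mu> = (\<lambda>a. f a 0) ` G\<mu>"
      using f_\<Phi> r center by (intro image_cong) simp_all
    then have orbit: "(\<lambda>a. \<Phi> a ze) ` G\<mu> \<subseteq> U"
      using U(2) by simp
    have stay: "u t \<in> T \<and> P (u t) < \<epsilon>"
      if u: "integral_curve A XH I u" and "0 \<in> I" "u 0 \<in> U" "t \<in> I" for I u t
    proof -
      have "is_interval I" "continuous_on I u"
        using u unfolding integral_curve_def by simp_all
      moreover have "\<forall>s\<in>I. \<forall>t\<in>I. E (u s) = E (u t)"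
        using E_flow[OF u] by blast
      ultimately show ?thesis
        using stable[rule_format, of I u t] that(2-4) by blast
    qed
    show "\<exists>U. open U \<and> (\<lambda>a. \<Phi> a ze) ` G\<mu> \<subseteq> U \<and>
           (\<forall>I u. integral_curve A XH I u \<and> 0 \<in> I \<and> u 0 \<in> U \<longrightarrow>
              (\<forall>t\<in>I. 0 \<le> t \<longrightarrow> u t \<in> T \<and> P (u t) < \<epsilon>))"
    proof (intro exI[of _ U] conjI[OF U(1) conjI[OF orbit]] allI impI ballI)
      fix I u t
      assume "integral_curve A XH I u \<and> 0 \<in> I \<and> u 0 \<in> U" and t: "t \<in> I"
      then show "u t \<in> T \<and> P (u t) < \<epsilon>"
        by (elim conjE) (rule stay)
    qed
  qed
qed

end
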